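(* Let $M$ be a smooth manifold of dimension $n\ge 3$ and let $F=\alpha\phi(s)$, $s=\beta/\alpha$, be an $(\alpha,\beta)$-metric on $M$ with $\beta$ nowhere zero. Then $F$ satisfies the $T$-condition, i.e. $T_{hijk}=0$ on $\mathcal D^*$, if and only if $\Phi=0$ on $\mathcal D^*$, where $$\Phi:=-\frac{\rho_1\phi}{2\alpha}\left(s+\alpha K_1m^2\right),\qquad K_1:=\frac{\rho_1}{2\alpha(\rho+m^2\phi\phi'')}.$$
   Context: $(\alpha,\beta)$-metrics. $M$ is an $n$-dimensional smooth manifold with induced local coordinates $(x^i,y^i)$ on $TM$; $\alpha=\sqrt{a_{ij}(x)y^iy^j}$ is the norm of a Riemannian metric, $\beta=b_i(x)y^i$ a 1-form. $(a^{ij})$ is the inverse of $(a_{ij})$, $b^i:=a^{ij}b_j$, $b^2:=b^ib_i$ (a function of $x$). Let $b_0>0$, let $J=(-b_0,b_0)$ or $J=(0,b_0)$, let $\phi:J\to\mathbb R$ be smooth, and assume $b(x)\le b_0$ for all $x$. $F:=\alpha\,\phi(s)$ with $s:=\beta/\alpha$, defined on the open set $\mathcal D$ of nonzero tangent vectors with $s\in J$. It is assumed that $\phi(t)>0$ and $\phi(t)-t\phi'(t)+(x^2-t^2)\phi''(t)>0$ for $t\in J$, $|t|<x<b_0$, and that $g_{ij}:=\frac12\frac{\partial^2F^2}{\partial y^i\partial y^j}$ is nondegenerate on $\mathcal D$, i.e. $\phi-s\phi'\ne0$ and $\phi-s\phi'+(b^2-s^2)\phi''\neq 0$ there. Primes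 denote derivatives in $s$. Put $\alpha_i:=\partial\alpha/\partial y^i$, $m_i:=b_i-s\alpha_i$, $m^2:=b^2-s^2=a^{ij}m_im_j$, and let $\mathcal D^*\subset\mathcal D$ be the set of points where $m_i\ne 0$ (equivalently $m^2\neq0$). Put $\rho:=\phi^2-s\phi\phi'$ and $\rho_1:=\phi\phi'-s(\phi'^2+\phi\phi'')$. $T$-tensor: with $\dot\partial_i=\partial/\partial y^i$, $C_{ijk}=\frac12\dot\partial_kg_{ij}$, $C^s_{ij}=g^{sr}C_{rij}$, $C_{rijk}=\dot\partial_rC_{ijk}$, $\ell_i=\dot\partial_iF$, $$T_{rijk}=FC_{rijk}-F(C_{sij}C^s_{rk}+C_{sjr}C^s_{ik}+C_{sir}C^s_{jk})+C_{rij}\ell_k+C_{rik}\ell_j+C_{rjk}\ell_i+C_{ijk}\ell_r .$$ *)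

theory Defs
  imports "HOL-Analysis.Analysis"
begin


definition pd :: "'n \<Rightarrow> (real^'n \<Rightarrow> real) \<Rightarrow> real^'n::finite \<Rightarrow> real" where
  "pd i f y = deriv (\<lambda>t. f (y + t *\<^sub>R axis i 1)) 0"

primrec iterated_pd :: "'n list \<Rightarrow> (real^'n \<Rightarrow> real) \<Rightarrow> real^'n::finite \<Rightarrow> real" where
  "iterated_pd [] f = f"
| "iterated_pd (i # is) f = pd i (iterated_pd is f)"

text \<open>Used for open \<open>U\<close> only: all iterated partial derivatives exist and are (Frechet)
  differentiable, hence continuous.\<close>

definition smooth_fun_on :: "(real^'n) set \<Rightarrow> (real^'n::finite \<Rightarrow> real) \<Rightarrow> bool" where
  "smooth_fun_on U f \<longleftrightarrow> (\<forall>is. iterated_pd is f differentiable_on U)"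

definition smooth_map_on :: "(real^'n) set \<Rightarrow> (real^'n::finite \<Rightarrow> real^'n) \<Rightarrow> bool" where
  "smooth_map_on U f \<longleftrightarrow> (\<forall>i. smooth_fun_on U (\<lambda>x. f x $ i))"

definition smooth_real_on :: "real set \<Rightarrow> (real \<Rightarrow> real) \<Rightarrow> bool" where
  "smooth_real_on J f \<longleftrightarrow> (\<forall>k. (deriv ^^ k) f differentiable_on J)"

type_synonym ('m, 'n) chart = "'m set \<times> ('m \<Rightarrow> real^'n)"

definition chart_inv :: "('m, 'n::finite) chart \<Rightarrow> real^'n \<Rightarrow> 'm" where
  "chart_inv \<kappa> = the_inv_into (fst \<kappa>) (snd \<kappa>)"

definition transition :: "('m, 'n::finite) chart \<Rightarrow> ('m, 'n) chart \<Rightarrow> real^'n \<Rightarrow> real^'n" where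
  "transition \<kappa> \<kappa>' = snd \<kappa>' \<circ> chart_inv \<kappa>"

text \<open>\<open>M\<close> with the atlas \<open>A\<close> is a smooth manifold of dimension \<open>CARD('n)\<close>;
  it is Hausdorff and second countable because the type \<open>'m\<close> is.\<close>

definition smooth_manifold ::
  "'m::{t2_space, second_countable_topology} set \<Rightarrow> ('m, 'n::finite) chart set \<Rightarrow> bool" where
  "smooth_manifold M A \<longleftrightarrow>
     (\<Union>\<kappa>\<in>A. fst \<kappa>) = M \<and>
     (\<forall>\<kappa>\<in>A. open (fst \<kappa>) \<and> open (snd \<kappa> ` fst \<kappa>) \<and>
        homeomorphism (fst \<kappa>) (snd \<kappa> ` fst \<kappa>) (snd \<kappa>) (chart_inv \<kappa>)) \<and>
     (\<forall>\<kappa>\<in>A. \<forall>\<kappa>'\<in>A.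
        smooth_map_on (snd \<kappa> ` (fst \<kappa> \<inter> fst \<kappa>')) (transition \<kappa> \<kappa>'))"

text \<open>A tensor field is the family of its components in the charts of the atlas, smooth in each
  chart and related by the transformation law on overlaps.\<close>

definition riemannian_metric ::
  "('m, 'n::finite) chart set \<Rightarrow> (('m, 'n) chart \<Rightarrow> 'm \<Rightarrow> real^'n^'n) \<Rightarrow> bool" where
  "riemannian_metric A a \<longleftrightarrow>
     (\<forall>\<kappa>\<in>A. \<forall>i j. smooth_fun_on (snd \<kappa> ` fst \<kappa>) (\<lambda>x. a \<kappa> (chart_inv \<kappa> x) $ i $ j)) \<and>
     (\<forall>\<kappa>\<in>A. \<forall>p\<in>fst \<kappa>. transpose (a \<kappa> p) = a \<kappa> p \<and>
        (\<forall>y. y \<noteq> 0 \<longrightarrow> y \<bullet> (a \<kappa> p *v y) > 0)) \<and>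
     (\<forall>\<kappa>\<in>A. \<forall>\<kappa>'\<in>A. \<forall>p \<in> fst \<kappa> \<inter> fst \<kappa>'.
        (let D = jacobian (transition \<kappa> \<kappa>') (at (snd \<kappa> p))
         in a \<kappa> p = transpose D ** a \<kappa>' p ** D))"

definition one_form ::
  "('m, 'n::finite) chart set \<Rightarrow> (('m, 'n) chart \<Rightarrow> 'm \<Rightarrow> real^'n) \<Rightarrow> bool" where
  "one_form A b \<longleftrightarrow>
     (\<forall>\<kappa>\<in>A. \<forall>i. smooth_fun_on (snd \<kappa> ` fst \<kappa>) (\<lambda>x. b \<kappa> (chart_inv \<kappa> x) $ i)) \<and>
     (\<forall>\<kappa>\<in>A. \<forall>\<kappa>'\<in>A. \<forall>p \<in> fst \<kappa> \<inter> fst \<kappa>'.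
        (let D = jacobian (transition \<kappa> \<kappa>') (at (snd \<kappa> p))
         in b \<kappa> p = transpose D *v b \<kappa>' p))"

text \<open>From here on \<open>a\<close> and \<open>b\<close> are the components \<open>a\<^sub>i\<^sub>j(x)\<close>, \<open>b\<^sub>i(x)\<close> at a fixed point \<open>x\<close> in
  a fixed chart, and \<open>y\<close> is the vector of induced coordinates of a tangent vector at \<open>x\<close>.\<close>

definition alpha :: "real^'n^'n \<Rightarrow> real^'n::finite \<Rightarrow> real" where
  "alpha a y = sqrt (\<Sum>i\<in>UNIV. \<Sum>j\<in>UNIV. a $ i $ j * y $ i * y $ j)"

definition beta :: "real^'n \<Rightarrow> real^'n::finite \<Rightarrow> real" where
  "beta b y = (\<Sum>i\<in>UNIV. b $ i * y $ i)"

definition s_var :: "real^'n^'n \<Rightarrow> real^'n \<Rightarrow> real^'n::finite \<Rightarrow> real" where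
  "s_var a b y = beta b y / alpha a y"

text \<open>\<open>\<phi>\<close> is a total function, but on the open set \<open>Dom J a b\<close> below \<open>Fm\<close> and its derivatives
  only involve its values on \<open>J\<close>.\<close>

definition Fm :: "(real \<Rightarrow> real) \<Rightarrow> real^'n^'n \<Rightarrow> real^'n \<Rightarrow> real^'n::finite \<Rightarrow> real" where
  "Fm \<phi> a b y = alpha a y * \<phi> (s_var a b y)"

definition b_sq :: "real^'n^'n \<Rightarrow> real^'n::finite \<Rightarrow> real" where
  "b_sq a b = (\<Sum>i\<in>UNIV. \<Sum>j\<in>UNIV. matrix_inv a $ i $ j * b $ j * b $ i)"

definition m_cov :: "real^'n^'n \<Rightarrow> real^'n \<Rightarrow> real^'n::finite \<Rightarrow> real^'n" where
  "m_cov a b y = (\<chi> i. b $ i - s_var a b y * pd i (alpha a) y)"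

definition m_sq :: "real^'n^'n \<Rightarrow> real^'n \<Rightarrow> real^'n::finite \<Rightarrow> real" where
  "m_sq a b y = b_sq a b - (s_var a b y)\<^sup>2"

definition Dom :: "real set \<Rightarrow> real^'n^'n \<Rightarrow> real^'n \<Rightarrow> (real^'n::finite) set" where
  "Dom J a b = {y. y \<noteq> 0 \<and> s_var a b y \<in> J}"

definition Dom_star :: "real set \<Rightarrow> real^'n^'n \<Rightarrow> real^'n \<Rightarrow> (real^'n::finite) set" where
  "Dom_star J a b = {y \<in> Dom J a b. m_cov a b y \<noteq> 0}"

definition g_mat :: "(real^'n \<Rightarrow> real) \<Rightarrow> real^'n::finite \<Rightarrow> real^'n^'n" where
  "g_mat F y = (\<chi> i j. 1 / 2 * pd i (pd j (\<lambda>z. (F z)\<^sup>2)) y)"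

definition C_low :: "(real^'n \<Rightarrow> real) \<Rightarrow> 'n \<Rightarrow> 'n \<Rightarrow> 'n \<Rightarrow> real^'n::finite \<Rightarrow> real" where
  "C_low F i j k y = 1 / 2 * pd k (\<lambda>z. g_mat F z $ i $ j) y"

text \<open>\<open>C_up F s i j\<close> is \<open>C\<^sup>s\<^sub>i\<^sub>j\<close>.\<close>

definition C_up :: "(real^'n \<Rightarrow> real) \<Rightarrow> 'n \<Rightarrow> 'n \<Rightarrow> 'n \<Rightarrow> real^'n::finite \<Rightarrow> real" where
  "C_up F s i j y = (\<Sum>r\<in>UNIV. matrix_inv (g_mat F y) $ s $ r * C_low F r i j y)"

definition T_tensor ::
  "(real^'n \<Rightarrow> real) \<Rightarrow> 'n \<Rightarrow> 'n \<Rightarrow> 'n \<Rightarrow> 'n \<Rightarrow> real^'n::finite \<Rightarrow> real" where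
  "T_tensor F r i j k y =
     F y * pd r (C_low F i j k) y
     - F y * (\<Sum>s\<in>UNIV. C_low F s i j y * C_up F s r k y
                       + C_low F s j r y * C_up F s i k y
                       + C_low F s i r y * C_up F s j k y)
     + C_low F r i j y * pd k F y + C_low F r i k y * pd j F y
     + C_low F r j k y * pd i F y + C_low F i j k y * pd r F y"

definition rho :: "(real \<Rightarrow> real) \<Rightarrow> real \<Rightarrow> real" where
  "rho \<phi> s = (\<phi> s)\<^sup>2 - s * \<phi> s * deriv \<phi> s"

definition rho1 :: "(real \<Rightarrow> real) \<Rightarrow> real \<Rightarrow> real" where
  "rho1 \<phi> s = \<phi> s * deriv \<phi> s - s * ((deriv \<phi> s)\<^sup>2 + \<phi> s * deriv (deriv \<phi>) s)"

definition K1 :: "(real \<Rightarrow> real) \<Rightarrow> real^'n^'n \<Rightarrow> real^'n \<Rightarrow> real^'n::finite \<Rightarrow> real" where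
  "K1 \<phi> a b y = (let s = s_var a b y in
     rho1 \<phi> s / (2 * alpha a y * (rho \<phi> s + m_sq a b y * \<phi> s * deriv (deriv \<phi>) s)))"

definition Phi :: "(real \<Rightarrow> real) \<Rightarrow> real^'n^'n \<Rightarrow> real^'n \<Rightarrow> real^'n::finite \<Rightarrow> real" where
  "Phi \<phi> a b y = (let s = s_var a b y in
     - (rho1 \<phi> s * \<phi> s / (2 * alpha a y)) * (s + alpha a y * K1 \<phi> a b y * m_sq a b y))"

end

theory Submission
  imports Defs
begin

text \<open>
  Write \<open>h\<^sub>i\<^sub>j = a\<^sub>i\<^sub>j - \<alpha>\<^sub>i \<alpha>\<^sub>j\<close>. At each point the \<open>T\<close>-tensor is a combination of the three symmetrised
  products \<open>h h\<close>, \<open>h m m\<close> and \<open>m m m m\<close>, whose coefficients are functions of \<open>s\<close> and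
  \<open>b\<^sup>2\<close> up to a factor \<open>1 / \<alpha>\<close>, the first one being \<open>\<Phi>\<close>. As \<open>n \<ge> 3\<close>, there is a vector \<open>v \<noteq> 0\<close> annihilated by
  \<open>\<alpha>\<^sub>i\<close> and \<open>m\<^sub>i\<close>, and contracting \<open>T\<close> four times with \<open>v\<close> isolates \<open>\<Phi>\<close>. Conversely, at a
  fixed point of \<open>M\<close>, \<open>s\<close> takes on \<open>\<D>\<^sup>*\<close> all values of an open set, so \<open>\<Phi> = 0\<close> is an ordinary
  differential equation for \<open>\<phi>\<close>, of the product form \<open>\<rho>\<^sub>1 E = 0\<close> with
  \<open>E = 2 s (\<rho> + m\<^sup>2 \<phi> \<phi>'') + \<rho>\<^sub>1 m\<^sup>2\<close>. On open sets where \<open>\<rho>\<^sub>1 = 0\<close> the metric is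
  Riemannian; on those where \<open>\<rho>\<^sub>1\<close> has no zero, differentiating \<open>E = 0\<close> twice makes the other two coefficients vanish.
  The union of these open sets is dense, and the coefficients are continuous.
\<close>

subsection \<open>The differential equation\<close>

text \<open>If \<open>Z\<close> were nonzero somewhere, it would be nonzero on an open set. In that
  set minus \<open>0\<close>, either \<open>r\<close> is nonzero at a point and hence on a smaller
  open set, or \<open>r\<close> vanishes identically; both contradict the hypothesis. The point
  \<open>0\<close> is left out because the applications divide by \<open>t\<close>.\<close>

lemma zero_by_density:
  fixes Z r :: "real \<Rightarrow> real"
  assumes "open I" "continuous_on I Z" "continuous_on I r"
    and *: "\<And>t U. \<lbrakk>open U; U \<subseteq> I; t \<in> U; 0 \<notin> U; (\<forall>x\<in>U. r x \<noteq> 0) \<or> (\<forall>x\<in>U. r x = 0)\<rbrakk> \<Longrightarrow> Z t = 0"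
    and "t \<in> I"
  shows "Z t = 0"
proof (rule ccontr)
  assume nz: "Z t \<noteq> 0"
  define N where "N = {x \<in> I. Z x \<noteq> 0}"
  have N: "open N" "t \<in> N" "N \<subseteq> I"
    using continuous_open_preimage[OF assms(2,1), of "- {0}"] nz assms(5)
    by (auto simp: N_def vimage_def Int_def)
  have "open (N - {0})" using N(1) by auto
  \<comment> \<open>Singletons are not open in the reals, so removing \<open>0\<close> cannot
    exhaust \<open>N\<close>.\<close>
  have "N - {0} \<noteq> {}"
    using N(1,2) by (metis not_open_singleton insert_absorb insert_Diff_single empty_iff insert_iff subset_singletonD Diff_eq_empty_iff)
  show False
  proof (cases "\<exists>x\<in>N - {0}. r x \<noteq> 0")
    case True
    then obtain x where x: "x \<in> N - {0}" "r x \<noteq> 0" by auto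
    define U where "U = (N - {0}) \<inter> (I \<inter> r -` (- {0}))"
    have "open U"
      unfolding U_def using \<open>open (N - {0})\<close>
      by (intro open_Int[of "N - {0}"] continuous_open_preimage[OF assms(3,1)] open_Compl) auto
    then have "Z x = 0" using x N(3) by (intro *[of U]) (auto simp: U_def)
    then show False using x by (simp add: N_def)
  next
    case False
    obtain x where x: "x \<in> N - {0}" using \<open>N - {0} \<noteq> {}\<close> by auto
    have "Z x = 0" by (rule *[OF \<open>open (N - {0})\<close> _ x]) (use False N(3) in auto)
    then show False using x by (simp add: N_def)
  qed
qed

text \<open>\<open>f3\<close> and \<open>f4\<close> stand for the third and fourth derivatives of \<open>p0\<^sup>2 / 2\<close>, and \<open>B\<close> for \<open>b\<^sup>2\<close>.\<close>

locale tcond_ode =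
  fixes I :: "real set" and B :: real and p0 p1 p2 f3 f4 \<rho> \<rho>1 D :: "real \<Rightarrow> real"
  assumes open_I: "open I"
    and B: "\<And>t. t \<in> I \<Longrightarrow> t\<^sup>2 < B"
    and p0: "\<And>t. t \<in> I \<Longrightarrow> 0 < p0 t"
    and d0: "\<And>t. t \<in> I \<Longrightarrow> (p0 has_real_derivative p1 t) (at t)"
    and d1: "\<And>t. t \<in> I \<Longrightarrow> (p1 has_real_derivative p2 t) (at t)"
    and d2: "continuous_on I p2"
    and d3: "\<And>t. t \<in> I \<Longrightarrow> (f3 has_real_derivative f4 t) (at t)"
    and d4: "continuous_on I f4"
    and r: "\<And>t. t \<in> I \<Longrightarrow> (\<rho> has_real_derivative \<rho>1 t) (at t)"
    and r1: "\<And>t. t \<in> I \<Longrightarrow> (\<rho>1 has_real_derivative - t * f3 t) (at t)"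
    and rho: "\<And>t. t \<in> I \<Longrightarrow> \<rho> t = p0 t * (p0 t - t * p1 t)"
    and rho1: "\<And>t. t \<in> I \<Longrightarrow> \<rho>1 t = p0 t * p1 t - t * ((p1 t)\<^sup>2 + p0 t * p2 t)"
    and D: "\<And>t. t \<in> I \<Longrightarrow> D t = \<rho> t + (B - t\<^sup>2) * p0 t * p2 t"
    and rho_nz: "\<And>t. t \<in> I \<Longrightarrow> \<rho> t \<noteq> 0"
    and D_nz: "\<And>t. t \<in> I \<Longrightarrow> D t \<noteq> 0"
    and E: "\<And>t. t \<in> I \<Longrightarrow> \<rho>1 t * (2 * t * D t + \<rho>1 t * (B - t\<^sup>2)) = 0"
begin

text \<open>Allows an identity valid only on \<open>U\<close> to be differentiated there.\<close>

lemma unique: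
  assumes "open U" "U \<subseteq> I" "t \<in> U" "\<And>x. x \<in> U \<Longrightarrow> f x = g x"
    and "(f has_real_derivative d) (at t)" "(g has_real_derivative e) (at t)"
  shows "d = e"
proof -
  have "(g has_real_derivative d) (at t)"
    by (rule has_field_derivative_transform_within_open[OF assms(5,1,3)]) (use assms(4) in auto)
  then show ?thesis using assms(6) DERIV_unique by blast
qed

text \<open>Differentiating \<open>\<rho>1 = 0\<close> gives \<open>t * f3 t = 0\<close>, and
  \<open>t\<close> cancels away from \<open>0\<close>.\<close>

lemma f3_f4_zero:
  assumes "open U" "U \<subseteq> I" "0 \<notin> U" "\<forall>x\<in>U. \<rho>1 x = 0" "t \<in> U"
  shows "f3 t = 0" "f4 t = 0"
proof -
  have *: "f3 x = 0" if "x \<in> U" for x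
  proof -
    have "- x * f3 x = 0"
      by (rule unique[OF assms(1,2) that, of \<rho>1 "\<lambda>_. 0"]) (use assms that r1 in auto)
    then show ?thesis using that assms(3) by auto
  qed
  show "f3 t = 0" using * assms by auto
  show "f4 t = 0"
    by (rule unique[OF assms(1,2,5), of f3 "\<lambda>_. 0"]) (use * assms d3 in auto)
qed

text \<open>As \<open>\<rho>1\<close> is the derivative of \<open>\<rho>\<close>,
  \<open>rho1_v\<close> makes \<open>v\<close> half the logarithmic derivative of
  \<open>\<rho>\<close> on sets where \<open>\<rho>1\<close> has no zero.\<close>

definition "v t = p1 t / p0 t + t / (B - t\<^sup>2)"
definition "k t = 2 * v t + 2 * t / (B - t\<^sup>2) - 1 / t"

context
  fixes U assumes U: "open U" "U \<subseteq> I" "0 \<notin> U" "\<forall>x\<in>U. \<rho>1 x \<noteq> 0"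
begin

lemma E_zero: "t \<in> U \<Longrightarrow> 2 * t * D t + \<rho>1 t * (B - t\<^sup>2) = 0"
  using E[of t] U by auto

text \<open>By its definition \<open>\<rho>1\<close> determines \<open>t * p0 t * p2 t\<close>;
  inserting this into \<open>E_zero\<close> removes the second derivative and leaves a linear
  equation for \<open>\<rho>1 t\<close>.\<close>

lemma rho1_v: assumes "t \<in> U" shows "\<rho>1 t = 2 * \<rho> t * v t"
proof -
  have tI: "t \<in> I" and t: "t \<noteq> 0" using assms U by auto
  define M where "M = B - t\<^sup>2"
  have M: "M \<noteq> 0" using B[OF tI] by (simp add: M_def)
  have p: "p0 t \<noteq> 0" using p0[OF tI] by auto
  have "2 * t * D t + \<rho>1 t * M = 0" using E_zero[OF assms] M_def by simp
  then have "\<rho>1 t * M = 2 * \<rho> t * (M * p1 t / p0 t + t)"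
    using p unfolding D[OF tI] rho1[OF tI] rho[OF tI] M_def[symmetric]
    by (simp add: divide_simps) algebra
  then show ?thesis using M unfolding v_def M_def[symmetric] by (simp add: field_simps)
qed

lemma rho1_D: assumes "t \<in> U" shows "1 / D t = - (2 * t) / (\<rho>1 t * (B - t\<^sup>2))"
proof -
  have tI: "t \<in> I" using assms U by auto
  have *: "\<rho>1 t * (B - t\<^sup>2) = - (2 * t * D t)" using E_zero[OF assms] by linarith
  have "D t \<noteq> 0" "t \<noteq> 0" using D_nz tI assms U by auto
  then show ?thesis unfolding * by simp
qed

text \<open>\<open>E = 0\<close> makes \<open>v\<close> a multiple of \<open>1 / (t (B - t\<^sup>2))\<close>, so that \<open>k\<close>, the logarithmic derivative
  of \<open>\<rho>\<^sub>1 = 2 \<rho> v\<close>, is explicit in \<open>v\<close> and \<open>t\<close>.\<close>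

lemma v_deriv: assumes "t \<in> U"
  shows "(v has_real_derivative v t * (2 * t / (B - t\<^sup>2) - 1 / t)) (at t)"
proof -
  have tI: "t \<in> I" and t: "t \<noteq> 0" using assms U by auto
  have p: "p0 t \<noteq> 0" using p0[OF tI] by auto
  define M where "M = B - t\<^sup>2"
  have M: "M \<noteq> 0" using B[OF tI] by (simp add: M_def)
  have "2 * t * D t + \<rho>1 t * M = 0" using E_zero[OF assms] M_def by simp
  \<comment> \<open>The equation solved for \<open>p2\<close>, so that the derivative of
    \<open>v\<close> involves only \<open>p0\<close>, \<open>p1\<close> and
    \<open>t\<close>.\<close>
  then have e: "p2 t * t * M = - (p0 t - t * p1 t) * (2 * t + M * p1 t / p0 t)"
    using p unfolding D[OF tI] rho1[OF tI] rho[OF tI] M_def[symmetric]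
    by (simp add: divide_simps) algebra
  have "(v has_real_derivative ((p2 t * p0 t - p1 t * p1 t) / (p0 t * p0 t) +
      (M + 2 * t * t) / (M * M))) (at t)"
    unfolding v_def[abs_def] using p M
    by (auto intro!: derivative_eq_intros d0 d1 tI simp: M_def power2_eq_square)
  moreover have "(p2 t * p0 t - p1 t * p1 t) / (p0 t * p0 t) + (M + 2 * t * t) / (M * M)
     = v t * (2 * t / M - 1 / t)"
  proof -
    have e2: "p2 t = - (p0 t - t * p1 t) * (2 * t + M * p1 t / p0 t) / (t * M)"
      using e t M by (simp add: field_simps)
    show ?thesis unfolding e2 v_def M_def[symmetric] using p M t
      by (simp add: field_simps)
  qed
  ultimately show ?thesis by (simp add: M_def)
qed

text \<open>Differentiating \<open>\<rho>1 = 2 * \<rho> * v\<close> gives \<open>- t * f3 t\<close>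
  on the left and, by \<open>v_deriv\<close>, \<open>\<rho>1 t * k t\<close> on the right.\<close>

lemma f3_k: assumes "t \<in> U" shows "f3 t = - \<rho>1 t * k t / t"
proof -
  have tI: "t \<in> I" and t: "t \<noteq> 0" using assms U by auto
  have "((\<lambda>t. 2 * \<rho> t * v t) has_real_derivative
      2 * (\<rho>1 t * v t + \<rho> t * (v t * (2 * t / (B - t\<^sup>2) - 1 / t)))) (at t)"
    by (rule derivative_eq_intros r v_deriv tI assms refl)+ (simp add: algebra_simps)
  then have "- t * f3 t = 2 * (\<rho>1 t * v t + \<rho> t * (v t * (2 * t / (B - t\<^sup>2) - 1 / t)))"
    using unique[OF U(1,2) assms rho1_v r1[OF tI]] by blast
  also have "\<dots> = \<rho>1 t * k t"
    unfolding rho1_v[OF assms] k_def by (simp add: algebra_simps)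
  finally show ?thesis using t by (simp add: field_simps)
qed

text \<open>The derivative of \<open>f3_k\<close>: the bracket is k^2 + k' - k/t, where k^2 comes
  from \<rho>1' = \<rho>1 k and the last term from the denominator t.\<close>

lemma f4_k: assumes "t \<in> U"
  shows "f4 t = - \<rho>1 t * ((k t)\<^sup>2 + (2 * v t * (2 * t / (B - t\<^sup>2) - 1 / t)
     + 2 / (B - t\<^sup>2) + 4 * t\<^sup>2 / (B - t\<^sup>2)\<^sup>2 + 1 / t\<^sup>2) - k t / t) / t"
proof -
  have tI: "t \<in> I" and t: "t \<noteq> 0" using assms U by auto
  define M where "M = B - t\<^sup>2"
  have M: "M \<noteq> 0" using B[OF tI] by (simp add: M_def)
  let ?k' = "2 * (v t * (2 * t / M - 1 / t)) + (2 / M + 4 * t\<^sup>2 / M\<^sup>2) + 1 / t\<^sup>2"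
  have k': "(k has_real_derivative ?k') (at t)"
  proof -
    have "(k has_real_derivative 2 * (v t * (2 * t / M - 1 / t)) + (2 * M + 2 * t * (2 * t)) / (M * M)
       + 1 / (t * t)) (at t)"
      unfolding k_def[abs_def] using M t
      by (auto intro!: derivative_eq_intros v_deriv assms simp: M_def power2_eq_square)
    also have "(2 * M + 2 * t * (2 * t)) / (M * M) = 2 / M + 4 * t\<^sup>2 / M\<^sup>2"
      using M by (simp add: field_simps power2_eq_square)
    finally show ?thesis by (simp add: power2_eq_square)
  qed
  have "f4 t = - ((- t * f3 t) * k t + \<rho>1 t * ?k') / t + \<rho>1 t * k t / t\<^sup>2"
  proof -
    have "f4 t = ((- (- t * f3 t) * k t + ?k' * (- \<rho>1 t)) * t - (- \<rho>1 t * k t) * 1) / (t * t)"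
      by (rule unique[OF U(1,2) assms f3_k d3[OF tI]
            DERIV_divide[OF DERIV_mult[OF DERIV_minus[OF r1[OF tI]] k'] DERIV_ident t]])
    then have "f4 t = (- (- t * f3 t * k t + \<rho>1 t * ?k') * t - - (\<rho>1 t * k t) * 1) / (t * t)"
      by (simp add: mult.commute)
    moreover have "(- z * t - - r * 1) / (t * t) = - z / t + r / t\<^sup>2" for z r
      using t by (simp add: divide_simps power2_eq_square)
    ultimately show ?thesis by metis
  qed
  also have "- t * f3 t = \<rho>1 t * k t" using f3_k[OF assms] t by simp
  finally have "f4 t = - (\<rho>1 t * k t * k t + \<rho>1 t * ?k') / t + \<rho>1 t * k t / t\<^sup>2" .
  moreover have "- (r * c * c + r * d) / t + r * c / t\<^sup>2 = - r * (c\<^sup>2 + d - c / t) / t" for r c d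
    using t by (simp add: divide_simps) algebra
  ultimately show ?thesis unfolding M_def[symmetric] by (simp add: mult.assoc)
qed

end

text \<open>\<open>\<Psi>\<close> and \<open>\<Omega>\<close> are the later \<open>hmm_coeff\<close>
  and \<open>mmmm_coeff\<close> as functions of \<open>t = s\<close> at a fixed point of the
  manifold, where m^2 is \<open>B - t\<^sup>2\<close>.\<close>

definition "\<Psi> t = - f3 t * (2 * t + \<rho>1 t * (B - t\<^sup>2) / D t) + 4 * p1 t * \<rho>1 t / p0 t
   - 2 * (\<rho>1 t)\<^sup>2 * (1 / D t + 1 / \<rho> t)"
definition "\<Omega> t = 2 * f4 t + 8 * p1 t * f3 t / p0 t - 3 * (f3 t)\<^sup>2 * (B - t\<^sup>2) / D t
   - 12 * \<rho>1 t * f3 t / D t + 12 * (\<rho>1 t)\<^sup>2 * p0 t * p2 t / (\<rho> t * D t)"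

lemma continuous_aux:
  "continuous_on I p0" "continuous_on I p1" "continuous_on I f3" "continuous_on I \<rho>" "continuous_on I \<rho>1"
  "continuous_on I D"
proof -
  show *: "continuous_on I p0" "continuous_on I p1" "continuous_on I f3" "continuous_on I \<rho>" "continuous_on I \<rho>1"
    using d0 d1 d3 r r1 by (meson DERIV_continuous continuous_at_imp_continuous_on)+
  have "continuous_on I (\<lambda>t. \<rho> t + (B - t\<^sup>2) * p0 t * p2 t)"
    by (intro continuous_intros * d2)
  then show "continuous_on I D" by (rule continuous_on_eq) (simp add: D)
qed

text \<open>Where \<open>\<rho>1\<close> vanishes identically, so does \<open>f3\<close>, and every
  term is zero. Where \<open>\<rho>1\<close> has no zero, \<open>E_zero\<close> kills the factor of
  \<open>f3\<close>, and the other terms cancel once \<open>\<rho>1 / D\<close> and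
  \<open>\<rho>1 / \<rho>\<close> are expressed by p1/p0 and t/M.\<close>

lemma Psi_zero: assumes "t \<in> I" shows "\<Psi> t = 0"
proof (rule zero_by_density[OF open_I _ continuous_aux(5) _ assms])
  show "continuous_on I \<Psi>"
    unfolding \<Psi>_def[abs_def]
    by (intro continuous_intros continuous_aux) (use D_nz rho_nz p0 in force)+
next
  fix t U assume U: "open U" "U \<subseteq> I" "t \<in> U" "0 \<notin> U" and *: "(\<forall>x\<in>U. \<rho>1 x \<noteq> 0) \<or> (\<forall>x\<in>U. \<rho>1 x = 0)"
  show "\<Psi> t = 0"
  proof (cases "\<forall>x\<in>U. \<rho>1 x = 0")
    case True
    then show ?thesis using f3_f4_zero[OF U(1,2,4) True U(3)] U(3) by (simp add: \<Psi>_def)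
  next
    case False
    then have nz: "\<forall>x\<in>U. \<rho>1 x \<noteq> 0" using * by auto
    note U' = U(1,2,4) nz U(3)
    have tI: "t \<in> I" and t: "t \<noteq> 0" using U by auto
    define M where "M = B - t\<^sup>2"
    have M: "M \<noteq> 0" using B[OF tI] by (simp add: M_def)
    have 1: "2 * t + \<rho>1 t * M / D t = 0"
      using E_zero[OF U'] D_nz[OF tI] by (simp add: M_def field_simps)
    have 2: "\<rho>1 t * (1 / D t) = - 2 * t / M"
      using rho1_D[OF U'] nz U(3) by (simp add: M_def)
    have 3: "\<rho>1 t * (1 / \<rho> t) = 2 * p1 t / p0 t + 2 * t / M"
      using rho1_v[OF U'] rho_nz[OF tI] by (simp add: v_def M_def)
    have "\<Psi> t = - f3 t * (2 * t + \<rho>1 t * M / D t) + 4 * p1 t * \<rho>1 t / p0 t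
      - 2 * \<rho>1 t * (\<rho>1 t * (1 / D t) + \<rho>1 t * (1 / \<rho> t))"
      by (simp add: \<Psi>_def M_def algebra_simps power2_eq_square)
    then show ?thesis unfolding 1 2 3 by (simp add: algebra_simps)
  qed
qed

text \<open>Same two cases as for \<open>\<Psi>\<close>. In the second one \<open>f3\<close>,
  \<open>f4\<close>, \<open>1 / D\<close> and \<open>1 / \<rho>\<close> are eliminated, and a
  polynomial identity in \<open>\<rho>1\<close>, \<open>v\<close>, t/M and 1/t remains.\<close>

lemma Omega_zero: assumes "t \<in> I" shows "\<Omega> t = 0"
proof (rule zero_by_density[OF open_I _ continuous_aux(5) _ assms])
  show "continuous_on I \<Omega>"
    unfolding \<Omega>_def[abs_def]
    by (intro continuous_intros continuous_aux d2 d4) (use D_nz rho_nz p0 in force)+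
next
  fix t U assume U: "open U" "U \<subseteq> I" "t \<in> U" "0 \<notin> U" and *: "(\<forall>x\<in>U. \<rho>1 x \<noteq> 0) \<or> (\<forall>x\<in>U. \<rho>1 x = 0)"
  show "\<Omega> t = 0"
  proof (cases "\<forall>x\<in>U. \<rho>1 x = 0")
    case True
    then show ?thesis using f3_f4_zero[OF U(1,2,4) True U(3)] U(3) by (simp add: \<Omega>_def)
  next
    case False
    then have nz: "\<forall>x\<in>U. \<rho>1 x \<noteq> 0" using * by auto
    note U' = U(1,2,4) nz U(3)
    have tI: "t \<in> I" and t: "t \<noteq> 0" using U by auto
    define M where "M = B - t\<^sup>2"
    have M: "M \<noteq> 0" using B[OF tI] by (simp add: M_def)
    note nz' = rho_nz[OF tI] D_nz[OF tI]
    define d where "d = 1 / D t"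
    have 2: "\<rho>1 t * d = - 2 * t / M"
      using rho1_D[OF U'] nz U(3) by (simp add: M_def d_def)
    have 3: "\<rho>1 t / \<rho> t = 2 * v t"
      using rho1_v[OF U'] rho_nz[OF tI] by simp
    \<comment> \<open>Partial fractions, using \<open>D - \<rho> = M * p0 * p2\<close>.\<close>
    have 4: "p0 t * p2 t / (\<rho> t * D t) = (1 / \<rho> t - d) / M"
    proof -
      have "p0 t * p2 t = (D t - \<rho> t) / M"
        using D[OF tI] M by (simp add: M_def[symmetric] eq_divide_eq mult_ac)
      then show ?thesis using nz' M by (simp add: d_def divide_simps)
    qed
    have "(\<rho>1 t)\<^sup>2 * p0 t * p2 t / (\<rho> t * D t) = (\<rho>1 t)\<^sup>2 * (p0 t * p2 t / (\<rho> t * D t))" by simp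
    also have "\<dots> = \<rho>1 t * (\<rho>1 t / \<rho> t - \<rho>1 t * d) / M"
      unfolding 4 by (simp add: power2_eq_square algebra_simps)
    also have "\<dots> = \<rho>1 t * (2 * v t + 2 * t / M) / M"
      unfolding 2 3 by simp
    finally have 5: "(\<rho>1 t)\<^sup>2 * p0 t * p2 t / (\<rho> t * D t) = \<rho>1 t * (2 * v t + 2 * t / M) / M" .
    have 6: "p1 t / p0 t = v t - t / M" by (simp add: v_def M_def)
    have "\<Omega> t = 2 * f4 t + 8 * (p1 t / p0 t) * f3 t - 3 * (f3 t) * (f3 t * d) * M
   - 12 * \<rho>1 t * (f3 t * d) + 12 * ((\<rho>1 t)\<^sup>2 * p0 t * p2 t / (\<rho> t * D t))"
      by (simp add: \<Omega>_def M_def d_def power2_eq_square)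
    also have "f3 t * d = 2 * k t / M"
    proof -
      have "f3 t * d = - (\<rho>1 t * d) * k t / t" using f3_k[OF U'] by simp
      then show ?thesis unfolding 2 using t by simp
    qed
    finally have 7: "\<Omega> t = 2 * f4 t + 8 * (v t - t / M) * f3 t - 6 * f3 t * k t
       - 24 * \<rho>1 t * k t / M + 12 * (\<rho>1 t * (2 * v t + 2 * t / M) / M)"
      unfolding 5 6 using M by simp
    \<comment> \<open>With \<open>1 / M = x * z\<close> all quotients disappear.\<close>
    define x where "x = t / M"
    define z where "z = 1 / t"
    have k: "k t = 2 * v t + 2 * x - z" by (simp add: k_def x_def z_def M_def)
    have f3: "f3 t = - \<rho>1 t * k t * z" using f3_k[OF U'] by (simp add: z_def)
    have f4: "f4 t = - \<rho>1 t * ((k t)\<^sup>2 + (2 * v t * (2 * x - z) + 2 * x * z + 4 * x\<^sup>2 + z\<^sup>2) - k t * z) * z"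
      unfolding f4_k[OF U'] unfolding M_def[symmetric] x_def z_def using t
      by (simp add: power_divide)
    have iM: "1 / M = x * z" using t by (simp add: x_def z_def)
    have "\<Omega> t = 2 * f4 t + 8 * (v t - x) * f3 t - 6 * f3 t * k t
       - 24 * \<rho>1 t * k t * (1 / M) + 12 * \<rho>1 t * (2 * v t + 2 * x) * (1 / M)"
      unfolding 7 x_def by simp
    then show ?thesis unfolding iM f4 f3 k by algebra
  qed
qed

end

subsection \<open>The \<open>T\<close>-tensor at a point\<close>

text \<open>A partial derivative at \<open>y\<close> sees only values near \<open>y\<close>, so
  \<open>f\<close> may be replaced by a closed formula valid on an open set. Iterated partial
  derivatives are computed this way, one after another.\<close>

lemma pd_eqI:
  fixes y :: "real^'n::finite"
  assumes "open U" "y \<in> U" "\<And>z. z \<in> U \<Longrightarrow> f z = g z"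
    and "((\<lambda>t. g (y + t *\<^sub>R axis i 1)) has_real_derivative d) (at 0)"
  shows "pd i f y = d"
proof -
  let ?S = "(\<lambda>t. y + t *\<^sub>R axis i 1) -` U"
  have "open ?S"
    using assms(1) by (intro open_vimage continuous_intros)
  moreover have "0 \<in> ?S" using assms(2) by simp
  ultimately have "((\<lambda>t. f (y + t *\<^sub>R axis i 1)) has_real_derivative d) (at 0)"
    using has_field_derivative_transform_within_open[OF assms(4), of ?S] assms(3) by auto
  then show ?thesis unfolding pd_def by (rule DERIV_imp_deriv)
qed

lemma alpha_eq: "alpha a y = sqrt (y \<bullet> (a *v y))"
  unfolding alpha_def inner_vec_def matrix_vector_mult_def
  by (simp add: sum_distrib_left mult_ac)

lemma beta_eq: "beta b y = b \<bullet> y"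
  by (simp add: beta_def inner_vec_def)

lemma b_sq_eq: "b_sq a b = b \<bullet> (matrix_inv a *v b)"
  unfolding b_sq_def inner_vec_def matrix_vector_mult_def
  by (simp add: sum_distrib_left mult_ac)

lemma matrix_inv_mult:
  fixes A :: "real^'n^'n"
  assumes "invertible A"
  shows "A ** matrix_inv A = mat 1" "matrix_inv A ** A = mat 1"
  using someI_ex[OF assms[unfolded invertible_def]] by (simp_all add: matrix_inv_def)

lemma invertible_ker:
  fixes A :: "real^'n^'n"
  assumes "invertible A" "A *v x = 0" shows "x = 0"
  using assms matrix_left_invertible_ker[of A] by (auto simp: invertible_left_inverse)

text \<open>\<open>p\<close> and \<open>q\<close> span at most a plane, hence a proper subspace.
  Every use of n \<ge> 3 goes through this lemma.\<close>

lemma exists_orthogonal_pair: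
  fixes p q :: "real^'n::finite"
  assumes "CARD('n) \<ge> 3"
  obtains v where "v \<noteq> 0" "p \<bullet> v = 0" "q \<bullet> v = 0"
proof -
  have "dim {p, q} \<le> card {p, q}" by (rule dim_le_card') simp
  also have "\<dots> \<le> 2" by (simp add: card_insert_if)
  also have "\<dots> < DIM(real^'n)" using assms by simp
  finally obtain v where "v \<noteq> 0" "\<And>y. y \<in> span {p, q} \<Longrightarrow> orthogonal v y"
    using orthogonal_to_subspace_exists by blast
  then show ?thesis
    by (intro that[of v]) (auto simp: orthogonal_def inner_commute span_base)
qed

text \<open>The data at one point of the manifold in one chart. All derivatives are taken in
  \<open>y\<close>, so \<open>a\<close> and \<open>b\<close> are constants.\<close>

locale alpha_beta_point =
  fixes a :: "real^'n^'n::finite" and b :: "real^'n" and J :: "real set" and \<phi> :: "real \<Rightarrow> real"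
  assumes sym: "transpose a = a"
    and pos: "\<And>y. y \<noteq> 0 \<Longrightarrow> 0 < y \<bullet> (a *v y)"
    and open_J: "open J"
    and smooth: "smooth_real_on J \<phi>"
    and phi_pos: "\<And>t. t \<in> J \<Longrightarrow> 0 < \<phi> t"
begin

abbreviation "\<alpha> \<equiv> alpha a"
abbreviation "s \<equiv> s_var a b"
abbreviation "F \<equiv> Fm \<phi> a b"
abbreviation "m2 \<equiv> m_sq a b"
abbreviation "\<phi>1 \<equiv> deriv \<phi>"
abbreviation "\<phi>2 \<equiv> deriv \<phi>1"
abbreviation "\<phi>3 \<equiv> deriv \<phi>2"
abbreviation "\<phi>4 \<equiv> deriv \<phi>3"
abbreviation "\<rho> \<equiv> rho \<phi>"
abbreviation "\<rho>1 \<equiv> rho1 \<phi>"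

text \<open>\<open>al\<close> is the gradient of \<alpha>, \<open>h\<close> is \<alpha> times its
  Hessian, and \<open>m\<close> is \<alpha> times the gradient of \<open>s\<close>; see
  \<open>der_alpha\<close>, \<open>der_al\<close> and \<open>der_s\<close>.\<close>

definition "al y = (1 / \<alpha> y) *\<^sub>R (a *v y)"
definition "m y = b - s y *\<^sub>R al y"
definition "h y i j = a $ i $ j - al y $ i * al y $ j"

text \<open>\<open>f2\<close>, \<open>f3\<close>, \<open>f4\<close> are the derivatives of \<open>\<phi>\<^sup>2 / 2\<close> of order 2, 3 and 4.\<close>

definition "f2 t = (\<phi>1 t)\<^sup>2 + \<phi> t * \<phi>2 t"
definition "f3 t = 3 * \<phi>1 t * \<phi>2 t + \<phi> t * \<phi>3 t"
definition "f4 t = 3 * (\<phi>2 t)\<^sup>2 + 4 * \<phi>1 t * \<phi>3 t + \<phi> t * \<phi>4 t"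

lemma a_sym: "a $ i $ j = a $ j $ i"
proof -
  have "a $ i $ j = transpose a $ j $ i" by (simp add: transpose_def)
  then show ?thesis by (simp add: sym)
qed

lemma inner_a: "x \<bullet> (a *v y) = (a *v x) \<bullet> y"
  using transpose_matrix_vector[of a x] by (simp add: dot_lmul_matrix sym)

lemma h_sym: "h y i j = h y j i"
  unfolding h_def by (subst a_sym) simp

lemma alpha_pos: "y \<noteq> 0 \<Longrightarrow> 0 < \<alpha> y"
  using pos by (simp add: alpha_eq)

lemma alpha_sq: "(\<alpha> y)\<^sup>2 = y \<bullet> (a *v y)"
  using pos[of y] by (cases "y = 0") (auto simp: alpha_eq)

lemma phi_derivs:
  assumes "t \<in> J"
  shows "(\<phi> has_real_derivative \<phi>1 t) (at t)" "(\<phi>1 has_real_derivative \<phi>2 t) (at t)"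
    "(\<phi>2 has_real_derivative \<phi>3 t) (at t)" "(\<phi>3 has_real_derivative \<phi>4 t) (at t)"
proof -
  have *: "((deriv ^^ k) \<phi> has_real_derivative (deriv ^^ Suc k) \<phi> t) (at t)" for k
    using smooth assms open_J unfolding smooth_real_on_def
    by (metis DERIV_deriv_iff_real_differentiable at_within_open comp_apply differentiable_on_def funpow.simps(2))
  show "(\<phi> has_real_derivative \<phi>1 t) (at t)" using *[of 0] by simp
  show "(\<phi>1 has_real_derivative \<phi>2 t) (at t)" using *[of 1] by simp
  show "(\<phi>2 has_real_derivative \<phi>3 t) (at t)" using *[of 2] by (simp add: numeral_2_eq_2)
  show "(\<phi>3 has_real_derivative \<phi>4 t) (at t)" using *[of 3] by (simp add: numeral_3_eq_3)
qed

text \<open>With f = \<open>\<phi>\<^sup>2 / 2\<close> one has \<rho> = 2 f - t f' and \<rho>1 = f'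
  - t f'', so that \<rho>' = \<rho>1 and \<rho>1' = - t f'''.\<close>

lemma rho1_deriv:
  assumes "t \<in> J" shows "(\<rho>1 has_real_derivative - t * f3 t) (at t)"
proof -
  note [derivative_intros] = phi_derivs[OF assms]
  show ?thesis unfolding rho1_def[abs_def] f3_def
    by (auto intro!: derivative_eq_intros simp: algebra_simps power2_eq_square)
qed

lemma rho_deriv:
  assumes "t \<in> J" shows "(\<rho> has_real_derivative \<rho>1 t) (at t)"
proof -
  note [derivative_intros] = phi_derivs[OF assms]
  show ?thesis unfolding rho1_def rho_def[abs_def]
    by (auto intro!: derivative_eq_intros simp: algebra_simps power2_eq_square)
qed

lemma f3_deriv:
  assumes "t \<in> J" shows "(f3 has_real_derivative f4 t) (at t)"
proof -
  note [derivative_intros] = phi_derivs[OF assms]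
  show ?thesis unfolding f3_def[abs_def] f4_def
    by (auto intro!: derivative_eq_intros simp: algebra_simps power2_eq_square)
qed

section \<open>Derivatives of \<alpha>, \<open>s\<close> and the covectors along the coordinate
  axes\<close>

lemma axis_inner: "axis i 1 \<bullet> (x :: real^'n) = x $ i"
  by (simp add: inner_axis')

lemma der_quad:
  "((\<lambda>t. (y + t *\<^sub>R axis i 1) \<bullet> (a *v (y + t *\<^sub>R axis i 1))) has_real_derivative 2 * (a *v y) $ i) (at 0)"
proof -
  have *: "(y + t *\<^sub>R axis i 1) \<bullet> (a *v (y + t *\<^sub>R axis i 1))
     = y \<bullet> (a *v y) + 2 * t * (a *v y) $ i + t\<^sup>2 * (axis i 1 \<bullet> (a *v axis i 1))" for t
    by (simp add: matrix_vector_right_distrib inner_add inner_a[of y "axis i 1"] axis_inner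
        matrix_vector_mult_scaleR inner_axis algebra_simps power2_eq_square)
  show ?thesis unfolding *
    by (auto intro!: derivative_eq_intros)
qed

lemma der_lin:
  "((\<lambda>t. (a *v (y + t *\<^sub>R axis i 1)) $ j) has_real_derivative a $ j $ i) (at 0)"
proof -
  have *: "(a *v (y + t *\<^sub>R axis i 1)) $ j = (a *v y) $ j + t * a $ j $ i" for t
    by (simp add: matrix_vector_right_distrib matrix_vector_mult_scaleR
       matrix_vector_mult_basis column_def)
  show ?thesis unfolding *
    by (auto intro!: derivative_eq_intros)
qed

context
  fixes y :: "real^'n" assumes y0: "y \<noteq> 0"
begin

lemma der_alpha:
  "((\<lambda>t. \<alpha> (y + t *\<^sub>R axis i 1)) has_real_derivative al y $ i) (at 0)"
proof -
  have "((\<lambda>t. sqrt ((y + t *\<^sub>R axis i 1) \<bullet> (a *v (y + t *\<^sub>R axis i 1)))) has_real_derivative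
      inverse (sqrt (y \<bullet> (a *v y))) / 2 * (2 * (a *v y) $ i)) (at 0)"
    using pos[OF y0] by (intro DERIV_chain2[OF DERIV_real_sqrt der_quad, THEN DERIV_cong]) auto
  moreover have "inverse (sqrt (y \<bullet> (a *v y))) / 2 * (2 * (a *v y) $ i) = al y $ i"
    by (simp add: al_def alpha_eq inverse_eq_divide)
  ultimately show ?thesis unfolding alpha_eq by metis
qed

lemma der_al:
  "((\<lambda>t. al (y + t *\<^sub>R axis i 1) $ j) has_real_derivative h y i j / \<alpha> y) (at 0)"
proof -
  have "((\<lambda>t. (a *v (y + t *\<^sub>R axis i 1)) $ j / \<alpha> (y + t *\<^sub>R axis i 1)) has_real_derivative
      (a $ j $ i * \<alpha> y - (a *v y) $ j * al y $ i) / (\<alpha> y * \<alpha> y)) (at 0)"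
    by (rule DERIV_cong[OF DERIV_divide[OF der_lin der_alpha]]) (use alpha_pos[OF y0] in simp_all)
  moreover have "(a $ j $ i * \<alpha> y - (a *v y) $ j * al y $ i) / (\<alpha> y * \<alpha> y) = h y j i / \<alpha> y"
    unfolding h_def using alpha_pos[OF y0] by (simp add: al_def field_simps)
  ultimately show ?thesis by (subst h_sym) (simp add: al_def)
qed

lemma der_s:
  "((\<lambda>t. s (y + t *\<^sub>R axis i 1)) has_real_derivative m y $ i / \<alpha> y) (at 0)"
proof -
  have *: "((\<lambda>t. beta b (y + t *\<^sub>R axis i 1)) has_real_derivative b $ i) (at 0)"
    by (auto simp: beta_eq inner_add inner_axis intro!: derivative_eq_intros)
  have "((\<lambda>t. s (y + t *\<^sub>R axis i 1)) has_real_derivative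
      (b $ i * \<alpha> y - beta b y * al y $ i) / (\<alpha> y * \<alpha> y)) (at 0)"
    unfolding s_var_def using alpha_pos[OF y0] DERIV_cong[OF DERIV_divide[OF * der_alpha]] by simp
  moreover have "(b $ i * \<alpha> y - beta b y * al y $ i) / (\<alpha> y * \<alpha> y) = m y $ i / \<alpha> y"
    using alpha_pos[OF y0] by (simp add: m_def s_var_def field_simps)
  ultimately show ?thesis by simp
qed

lemma der_m:
  "((\<lambda>t. m (y + t *\<^sub>R axis i 1) $ j) has_real_derivative
      - (m y $ i * al y $ j + s y * h y i j) / \<alpha> y) (at 0)"
  unfolding m_def[of "_ + _"]
  by (simp, (rule derivative_eq_intros der_al der_s refl)+)
    (simp add: m_def add_divide_distrib diff_divide_distrib algebra_simps)

lemma der_h: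
  "((\<lambda>t. h (y + t *\<^sub>R axis i 1) j k) has_real_derivative
      - (h y i j * al y $ k + h y i k * al y $ j) / \<alpha> y) (at 0)"
  unfolding h_def[of "_ + _"]
  by (rule derivative_eq_intros der_al refl)+ (simp add: diff_divide_distrib)

lemma der_comp:
  assumes "(f has_real_derivative d) (at (s y))"
  shows "((\<lambda>t. f (s (y + t *\<^sub>R axis i 1))) has_real_derivative d * (m y $ i / \<alpha> y)) (at 0)"
  using DERIV_chain2[OF _ der_s[of i]] assms by simp

lemma pd_alpha: "pd i \<alpha> y = al y $ i"
  by (rule pd_eqI[OF open_UNIV]) (auto intro: der_alpha)

lemma m_cov_eq: "m_cov a b y = m y"
  by (simp add: m_cov_def m_def vec_eq_iff pd_alpha)

end

section \<open>Components of the metric \<open>g\<close>, of the Cartan tensor and of its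
  derivatives\<close>

abbreviation "D \<equiv> Dom J a b"

lemma open_Dom: "open D"
proof -
  have "continuous_on (- {0}) s"
    unfolding s_var_def[abs_def] beta_eq alpha_eq
    by (intro continuous_intros) (use pos in force)
  then have "open ((- {0}) \<inter> s -` J)"
    using open_J by (intro continuous_open_preimage) auto
  also have "(- {0}) \<inter> s -` J = D" by (auto simp: Dom_def)
  finally show ?thesis .
qed

lemma pd_F: assumes "y \<in> D" shows "pd i F y = \<phi> (s y) * al y $ i + \<phi>1 (s y) * m y $ i"
proof (rule pd_eqI[OF open_Dom assms refl])
  have y0: "y \<noteq> 0" and sJ: "s y \<in> J" using assms by (auto simp: Dom_def)
  show "((\<lambda>t. F (y + t *\<^sub>R axis i 1)) has_real_derivative \<phi> (s y) * al y $ i + \<phi>1 (s y) * m y $ i) (at 0)"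
    unfolding Fm_def using alpha_pos[OF y0]
    by - ((rule derivative_eq_intros der_alpha der_comp y0 phi_derivs sJ refl)+, simp)
qed

lemma pd_Fsq: assumes "y \<in> D"
  shows "pd i (\<lambda>z. (F z)\<^sup>2) y = 2 * \<alpha> y * ((\<phi> (s y))\<^sup>2 * al y $ i + \<phi> (s y) * \<phi>1 (s y) * m y $ i)"
proof (rule pd_eqI[OF open_Dom assms refl])
  have y0: "y \<noteq> 0" and sJ: "s y \<in> J" using assms by (auto simp: Dom_def)
  show "((\<lambda>t. (F (y + t *\<^sub>R axis i 1))\<^sup>2) has_real_derivative
      2 * \<alpha> y * ((\<phi> (s y))\<^sup>2 * al y $ i + \<phi> (s y) * \<phi>1 (s y) * m y $ i)) (at 0)"
    unfolding Fm_def using alpha_pos[OF y0]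
    by - ((rule derivative_eq_intros der_alpha der_comp y0 phi_derivs sJ refl)+,
      simp add: field_simps power2_eq_square)
qed

lemma g_mat_eq: assumes "y \<in> D"
  shows "g_mat F y $ i $ j = (\<phi> (s y))\<^sup>2 * al y $ i * al y $ j
    + \<phi> (s y) * \<phi>1 (s y) * (m y $ i * al y $ j + m y $ j * al y $ i)
    + f2 (s y) * m y $ i * m y $ j + \<rho> (s y) * h y i j"
proof -
  have y0: "y \<noteq> 0" and sJ: "s y \<in> J" using assms by (auto simp: Dom_def)
  have "pd i (pd j (\<lambda>z. (F z)\<^sup>2)) y = 2 * ((\<phi> (s y))\<^sup>2 * al y $ i * al y $ j
    + \<phi> (s y) * \<phi>1 (s y) * (m y $ i * al y $ j + m y $ j * al y $ i)
    + f2 (s y) * m y $ i * m y $ j + \<rho> (s y) * h y i j)"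
    using alpha_pos[OF y0]
    apply -
    apply (rule pd_eqI[OF open_Dom assms], erule pd_Fsq)
    apply (rule derivative_eq_intros der_alpha der_al der_m der_comp y0 phi_derivs sJ refl)+
    apply (simp add: f2_def rho_def)
    apply (simp add: field_simps power2_eq_square)
    done
  then show ?thesis by (simp add: g_mat_def)
qed

definition "S y i j k = m y $ i * h y j k + m y $ j * h y i k + m y $ k * h y i j"

text \<open>All terms containing \<open>al\<close> cancel, as homogeneity forces: \<open>g\<close>
  has degree 0 in \<open>y\<close>, so \<open>y\<close> annihilates C; it also annihilates
  \<open>m\<close> and \<open>h\<close>, but not \<open>al\<close>.\<close>

lemma C_low_eq: assumes "y \<in> D"
  shows "C_low F i j k y = (\<rho>1 (s y) * S y i j k + f3 (s y) * m y $ i * m y $ j * m y $ k) / (2 * \<alpha> y)"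
proof -
  have y0: "y \<noteq> 0" and sJ: "s y \<in> J" using assms by (auto simp: Dom_def)
  have "pd k (\<lambda>z. g_mat F z $ i $ j) y = (\<rho>1 (s y) * S y i j k + f3 (s y) * m y $ i * m y $ j * m y $ k) / \<alpha> y"
    using alpha_pos[OF y0]
    apply -
    apply (rule pd_eqI[OF open_Dom assms], erule g_mat_eq)
    unfolding f2_def
    apply (rule derivative_eq_intros der_alpha der_al der_m der_h der_comp y0 phi_derivs rho_deriv sJ refl)+
    apply (simp add: h_sym[of y k])
    apply (simp add: field_simps power2_eq_square rho_def rho1_def f3_def S_def)
    done
  then show ?thesis by (simp add: C_low_def)
qed

definition "Q1 y r i j k = h y r i * h y j k + h y r j * h y i k + h y r k * h y i j"
definition "Q2 y r i j k =
  h y r i * m y $ j * m y $ k + h y r j * m y $ i * m y $ k + h y r k * m y $ i * m y $ j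
  + h y i j * m y $ r * m y $ k + h y i k * m y $ r * m y $ j + h y j k * m y $ r * m y $ i"
definition "Q3 y r i j k = m y $ r * m y $ i * m y $ j * m y $ k"

text \<open>Here terms with \<open>al\<close> do remain; in \<open>T_tensor\<close> they cancel
  against the \<open>al\<close> part of the gradient of \<open>F\<close>.\<close>

lemma pd_C_low: assumes "y \<in> D"
  shows "pd r (C_low F i j k) y =
    (- s y * f3 (s y) * Q2 y r i j k - s y * \<rho>1 (s y) * Q1 y r i j k + f4 (s y) * Q3 y r i j k
      - \<rho>1 (s y) * (al y $ r * S y i j k + al y $ i * S y r j k + al y $ j * S y r i k + al y $ k * S y r i j)
      - f3 (s y) * (al y $ r * m y $ i * m y $ j * m y $ k + al y $ i * m y $ r * m y $ j * m y $ k
         + al y $ j * m y $ r * m y $ i * m y $ k + al y $ k * m y $ r * m y $ i * m y $ j))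
    / (2 * (\<alpha> y)\<^sup>2)"
proof -
  have y0: "y \<noteq> 0" and sJ: "s y \<in> J" using assms by (auto simp: Dom_def)
  show ?thesis
    using alpha_pos[OF y0]
    apply -
    apply (rule pd_eqI[OF open_Dom assms], erule C_low_eq)
    unfolding S_def
    apply (rule derivative_eq_intros der_alpha der_al der_m der_h der_comp y0 f3_deriv rho1_deriv sJ refl)+
    apply simp
    apply (simp add: field_simps power2_eq_square Q1_def Q2_def Q3_def h_sym)
    done
qed

section \<open>Linear algebra of \<open>a\<close> and \<open>g\<close>\<close>

lemma a_ker: "a *v x = 0 \<Longrightarrow> x = 0"
  using pos[of x] by fastforce

lemma a_invertible: "invertible a"
  using a_ker matrix_left_invertible_ker[of a] by (auto simp: invertible_left_inverse)

lemma a_inv: "a *v (matrix_inv a *v x) = x"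
  by (simp add: matrix_vector_mul_assoc matrix_inv_mult(1)[OF a_invertible])

definition "hcol y k = (\<chi> i. h y i k)"

lemma hcol_eq: "hcol y k = a *v axis k 1 - (al y $ k) *\<^sub>R al y"
  by (simp add: hcol_def h_def vec_eq_iff matrix_vector_mult_basis column_def mult.commute)

lemma g_mult:
  assumes "y \<in> D"
  shows "g_mat F y *v x =
    ((\<phi> (s y))\<^sup>2 * (al y \<bullet> x) + \<phi> (s y) * \<phi>1 (s y) * (m y \<bullet> x)) *\<^sub>R al y
    + (\<phi> (s y) * \<phi>1 (s y) * (al y \<bullet> x) + f2 (s y) * (m y \<bullet> x)) *\<^sub>R m y
    + \<rho> (s y) *\<^sub>R (a *v x - (al y \<bullet> x) *\<^sub>R al y)"
proof -
  have "(g_mat F y *v x) $ i = ((\<phi> (s y))\<^sup>2 * (al y \<bullet> x) + \<phi> (s y) * \<phi>1 (s y) * (m y \<bullet> x)) * al y $ i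
    + (\<phi> (s y) * \<phi>1 (s y) * (al y \<bullet> x) + f2 (s y) * (m y \<bullet> x)) * m y $ i
    + \<rho> (s y) * ((a *v x) $ i - (al y \<bullet> x) * al y $ i)" for i
    by (simp add: matrix_vector_mult_def g_mat_eq[OF assms] h_def inner_vec_def
        sum.distrib sum_subtractf sum_distrib_left sum_distrib_right algebra_simps)
  then show ?thesis by (simp add: vec_eq_iff)
qed

context
  fixes y :: "real^'n" assumes y0: "y \<noteq> 0"
begin

lemma a_y: "a *v y = \<alpha> y *\<^sub>R al y"
  using alpha_pos[OF y0] by (simp add: al_def)

lemma al_y: "al y \<bullet> y = \<alpha> y"
  using alpha_pos[OF y0] alpha_sq[of y]
  by (simp add: al_def inner_commute[of "a *v y"] power2_eq_square divide_eq_eq)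

lemma m_y: "m y \<bullet> y = 0"
  using alpha_pos[OF y0] by (simp add: m_def inner_diff_left al_y s_var_def beta_eq)

lemma al_inv_a: "al y \<bullet> (matrix_inv a *v x) = (x \<bullet> y) / \<alpha> y"
  unfolding al_def by (simp add: inner_a[symmetric] a_inv inner_commute)

lemma al_inv_m: "al y \<bullet> (matrix_inv a *v m y) = 0"
  by (simp add: al_inv_a m_y)

text \<open>\<open>b = m y + s y *\<^sub>R al y\<close> is an orthogonal decomposition with respect
  to the inverse of \<open>a\<close>, in which \<open>al y\<close> has length 1.\<close>

lemma m_inv_m: "m y \<bullet> (matrix_inv a *v m y) = m2 y"
proof -
  have b_y: "b \<bullet> y = s y * \<alpha> y" using alpha_pos[OF y0] by (simp add: s_var_def beta_eq)
  have b: "b = m y + s y *\<^sub>R al y" by (simp add: m_def)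
  have "matrix_inv a *v al y = (1 / \<alpha> y) *\<^sub>R y"
    using a_ker[of "matrix_inv a *v al y - (1 / \<alpha> y) *\<^sub>R y"]
    by (simp add: matrix_vector_mult_diff_distrib a_inv matrix_vector_mult_scaleR al_def)
  then have "b \<bullet> (matrix_inv a *v b) = m y \<bullet> (matrix_inv a *v m y) + (s y)\<^sup>2"
    using alpha_pos[OF y0] al_y
    by (subst (1 2) b) (simp add: matrix_vector_right_distrib matrix_vector_mult_scaleR inner_add
       al_inv_m m_y power2_eq_square)
  then show ?thesis by (simp add: m_sq_def b_sq_eq)
qed

lemma m2_pos: assumes "m y \<noteq> 0" shows "0 < m2 y"
proof -
  have "matrix_inv a *v m y \<noteq> 0" using a_inv[of "m y"] assms by auto
  from pos[OF this] show ?thesis by (simp add: a_inv inner_commute m_inv_m)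
qed

end

text \<open>The denominator of \<open>K1\<close> without the factor \<open>2 * \<alpha> y\<close>.
  By \<open>g_V0\<close> it is the scalar through which \<open>m\<close> is reached by
  \<open>g\<close>.\<close>

definition "Dn y = \<rho> (s y) + m2 y * \<phi> (s y) * \<phi>2 (s y)"

text \<open>\<open>V\<close> and \<open>W k\<close> are the images under the inverse of \<open>g\<close> of the covectors \<open>m\<close> and \<open>h\<^sub>\<bullet>\<^sub>k\<close>.\<close>

definition "V y = (1 / Dn y) *\<^sub>R (matrix_inv a *v m y - (\<phi>1 (s y) / \<phi> (s y) * m2 y / \<alpha> y) *\<^sub>R y)"
definition "W y k = (1 / \<rho> (s y)) *\<^sub>R (axis k 1 -
   ((al y $ k + \<phi>1 (s y) / \<phi> (s y) * m y $ k) / \<alpha> y) *\<^sub>R y - (\<phi> (s y) * \<phi>2 (s y) * m y $ k) *\<^sub>R V y)"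

text \<open>The multiple of \<open>y\<close> is chosen to cancel the \<open>al\<close> component.
  There is no division by \<open>Dn y\<close>, because \<open>Dn_nonzero\<close> is derived from
  this equation.\<close>

lemma g_V0:
  assumes "y \<in> D"
  shows "g_mat F y *v (matrix_inv a *v m y - (\<phi>1 (s y) / \<phi> (s y) * m2 y / \<alpha> y) *\<^sub>R y) = Dn y *\<^sub>R m y"
proof -
  have y0: "y \<noteq> 0" and sJ: "s y \<in> J" using assms by (auto simp: Dom_def)
  note nz = alpha_pos[OF y0] phi_pos[OF sJ]
  define c where "c = \<phi>1 (s y) / \<phi> (s y)"
  have c: "\<phi>1 (s y) = c * \<phi> (s y)" using nz by (simp add: c_def)
  note y0_simps = al_inv_m[OF y0] m_inv_m[OF y0] al_y[OF y0] m_y[OF y0] a_y[OF y0]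
  show ?thesis
    using nz unfolding g_mult[OF assms] c_def[symmetric]
    by (simp add: inner_diff_right y0_simps matrix_vector_mult_diff_distrib
        a_inv matrix_vector_mult_scaleR vec_eq_iff)
      (simp add: c Dn_def f2_def algebra_simps power2_eq_square)
qed

lemma g_y:
  assumes "y \<in> D"
  shows "g_mat F y *v y = (\<alpha> y * (\<phi> (s y))\<^sup>2) *\<^sub>R al y + (\<alpha> y * \<phi> (s y) * \<phi>1 (s y)) *\<^sub>R m y"
proof -
  have y0: "y \<noteq> 0" using assms by (auto simp: Dom_def)
  show ?thesis unfolding g_mult[OF assms]
    by (simp add: al_y m_y y0 a_y mult_ac)
qed

text \<open>The coefficient of \<open>m\<close> when \<open>2 * \<alpha> y\<close> times C is read
  as a covector in its first index; see \<open>C_vec\<close>.\<close>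

definition "U y i j = \<rho>1 (s y) * h y i j + f3 (s y) * m y $ i * m y $ j"

text \<open>Up to the factor \<open>\<phi> (s y) / (4 * \<alpha> y)\<close> these are the
  coefficients of \<open>Q1\<close>, \<open>Q2\<close>, \<open>Q3\<close> in T, by
  \<open>T_eq\<close>; with that factor the first is \<Phi>, by \<open>Phi_eq\<close>.\<close>

definition "hh_coeff y = - \<rho>1 (s y) * (2 * s y + \<rho>1 (s y) * m2 y / Dn y)"
definition "hmm_coeff y = - f3 (s y) * (2 * s y + \<rho>1 (s y) * m2 y / Dn y)
   + 4 * \<phi>1 (s y) * \<rho>1 (s y) / \<phi> (s y) - 2 * (\<rho>1 (s y))\<^sup>2 * (1 / Dn y + 1 / \<rho> (s y))"
definition "mmmm_coeff y = 2 * f4 (s y) + 8 * \<phi>1 (s y) * f3 (s y) / \<phi> (s y) - 3 * (f3 (s y))\<^sup>2 * m2 y / Dn y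
   - 12 * \<rho>1 (s y) * f3 (s y) / Dn y
   + 12 * (\<rho>1 (s y))\<^sup>2 * \<phi> (s y) * \<phi>2 (s y) / (\<rho> (s y) * Dn y)"

section \<open>Raising an index of the Cartan tensor, and the formula for T\<close>

context
  fixes y :: "real^'n"
  assumes yD: "y \<in> D" and rho_nz: "\<rho> (s y) \<noteq> 0" and Dn_nz: "Dn y \<noteq> 0"
    and inv: "invertible (g_mat F y)"
begin

lemma y_nz: "y \<noteq> 0" and sJ: "s y \<in> J"
  using yD by (auto simp: Dom_def)

lemma g_V: "g_mat F y *v V y = m y"
  using g_V0[OF yD] Dn_nz by (simp add: V_def matrix_vector_mult_scaleR)

text \<open>In the image of the basis vector \<open>axis k 1\<close> under \<open>g\<close>, a
  multiple of the image of \<open>y\<close> removes the \<open>al\<close> component. What is left of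
  the \<open>m\<close> component is \<open>\<phi> * \<phi>2 * m $ k\<close>, which the multiple of
  \<open>V\<close> removes.\<close>

lemma g_W: "g_mat F y *v W y k = hcol y k"
proof -
  note nz = alpha_pos[OF y_nz] phi_pos[OF sJ]
  have "\<rho> (s y) *\<^sub>R (g_mat F y *v W y k) = g_mat F y *v (axis k 1 -
   ((al y $ k + \<phi>1 (s y) / \<phi> (s y) * m y $ k) / \<alpha> y) *\<^sub>R y - (\<phi> (s y) * \<phi>2 (s y) * m y $ k) *\<^sub>R V y)"
    unfolding W_def using rho_nz by (simp add: matrix_vector_mult_scaleR)
  also have "\<dots> = g_mat F y *v axis k 1 - ((al y $ k + \<phi>1 (s y) / \<phi> (s y) * m y $ k) / \<alpha> y) *\<^sub>R (g_mat F y *v y)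
    - (\<phi> (s y) * \<phi>2 (s y) * m y $ k) *\<^sub>R m y"
    by (simp add: matrix_vector_mult_diff_distrib matrix_vector_mult_scaleR g_V)
  also have "g_mat F y *v axis k 1 = ((\<phi> (s y))\<^sup>2 * al y $ k + \<phi> (s y) * \<phi>1 (s y) * m y $ k) *\<^sub>R al y
    + (\<phi> (s y) * \<phi>1 (s y) * al y $ k + f2 (s y) * m y $ k) *\<^sub>R m y + \<rho> (s y) *\<^sub>R hcol y k"
    unfolding g_mult[OF yD] hcol_eq by (simp add: inner_axis)
  also have "((\<phi> (s y))\<^sup>2 * al y $ k + \<phi> (s y) * \<phi>1 (s y) * m y $ k) *\<^sub>R al y
    + (\<phi> (s y) * \<phi>1 (s y) * al y $ k + f2 (s y) * m y $ k) *\<^sub>R m y + \<rho> (s y) *\<^sub>R hcol y k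
    - ((al y $ k + \<phi>1 (s y) / \<phi> (s y) * m y $ k) / \<alpha> y) *\<^sub>R (g_mat F y *v y)
    - (\<phi> (s y) * \<phi>2 (s y) * m y $ k) *\<^sub>R m y = \<rho> (s y) *\<^sub>R hcol y k"
    unfolding g_y[OF yD] using nz by (simp add: vec_eq_iff f2_def) (simp add: field_simps power2_eq_square)
  finally show ?thesis using rho_nz by simp
qed

lemma m_V: "m y \<bullet> V y = m2 y / Dn y"
  by (simp add: V_def inner_diff_right m_inv_m m_y y_nz)

lemma hcol_y: "hcol y j \<bullet> y = 0"
  using alpha_pos[OF y_nz]
  by (simp add: hcol_eq inner_diff_left al_y[OF y_nz] inner_a[symmetric] a_y[OF y_nz] axis_inner)

lemma hcol_V: "hcol y j \<bullet> V y = m y $ j / Dn y"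
proof -
  have "hcol y j \<bullet> (matrix_inv a *v m y) = m y $ j"
    by (simp add: hcol_eq inner_diff_left al_inv_m y_nz inner_a[symmetric] a_inv axis_inner)
  then show ?thesis by (simp add: V_def inner_diff_right hcol_y)
qed

lemma m_W: "m y \<bullet> W y k = m y $ k / Dn y"
proof -
  have "m y \<bullet> W y k = (m y $ k - \<phi> (s y) * \<phi>2 (s y) * m y $ k * (m2 y / Dn y)) / \<rho> (s y)"
    by (simp add: W_def inner_diff_right inner_axis m_y y_nz m_V)
  also have "\<dots> = m y $ k * (Dn y - m2 y * \<phi> (s y) * \<phi>2 (s y)) / (Dn y * \<rho> (s y))"
    using Dn_nz rho_nz by (simp add: divide_simps) (simp add: algebra_simps)
  also have "Dn y - m2 y * \<phi> (s y) * \<phi>2 (s y) = \<rho> (s y)" by (simp add: Dn_def)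
  finally show ?thesis using rho_nz by simp
qed

lemma hcol_W: "hcol y j \<bullet> W y k =
    (h y j k - \<phi> (s y) * \<phi>2 (s y) * m y $ j * m y $ k / Dn y) / \<rho> (s y)"
  by (simp add: W_def inner_diff_right inner_axis hcol_y hcol_V) (simp add: hcol_def h_sym mult_ac)

lemma C_vec: "(\<chi> r. C_low F r i j y) = (1 / (2 * \<alpha> y)) *\<^sub>R
    (U y i j *\<^sub>R m y + (\<rho>1 (s y) * m y $ i) *\<^sub>R hcol y j + (\<rho>1 (s y) * m y $ j) *\<^sub>R hcol y i)"
  by (simp add: vec_eq_iff C_low_eq[OF yD] U_def S_def hcol_def algebra_simps add_divide_distrib)

text \<open>By \<open>g_V\<close> and \<open>g_W\<close>, \<open>g\<close> maps the right-hand side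
  to the covector of \<open>C_vec\<close>; invertibility of \<open>g\<close> then identifies
  it.\<close>

lemma C_up_vec: "(\<chi> r. C_up F r i j y) = (1 / (2 * \<alpha> y)) *\<^sub>R
    (U y i j *\<^sub>R V y + (\<rho>1 (s y) * m y $ i) *\<^sub>R W y j + (\<rho>1 (s y) * m y $ j) *\<^sub>R W y i)" (is "_ = ?X")
proof -
  have "g_mat F y *v ?X = (\<chi> r. C_low F r i j y)"
    by (simp add: C_vec matrix_vector_mult_scaleR matrix_vector_right_distrib g_V g_W)
  moreover have "(\<chi> r. C_up F r i j y) = matrix_inv (g_mat F y) *v (\<chi> r. C_low F r i j y)"
    by (simp add: vec_eq_iff C_up_def matrix_vector_mult_def)
  moreover have "matrix_inv (g_mat F y) *v (g_mat F y *v ?X) = ?X"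
    by (simp only: matrix_vector_mul_assoc matrix_inv_mult(2)[OF inv] matrix_vector_mul_lid)
  ultimately show ?thesis by simp
qed

lemma C_C: "(\<Sum>t\<in>UNIV. C_low F t i j y * C_up F t r k y) =
   (U y i j * U y r k * m2 y / Dn y + 2 * \<rho>1 (s y) * (U y i j * m y $ r * m y $ k + U y r k * m y $ i * m y $ j) / Dn y
    + (\<rho>1 (s y))\<^sup>2 * (m y $ i * m y $ r * (hcol y j \<bullet> W y k) + m y $ i * m y $ k * (hcol y j \<bullet> W y r)
       + m y $ j * m y $ r * (hcol y i \<bullet> W y k) + m y $ j * m y $ k * (hcol y i \<bullet> W y r)))
   / (4 * (\<alpha> y)\<^sup>2)"
proof -
  have "(\<Sum>t\<in>UNIV. C_low F t i j y * C_up F t r k y) =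
    (\<chi> t. C_low F t i j y) \<bullet> (\<chi> t. C_up F t r k y)"
    by (simp add: inner_vec_def)
  also have "\<dots> = (1 / (4 * (\<alpha> y)\<^sup>2)) * ((U y i j *\<^sub>R m y + (\<rho>1 (s y) * m y $ i) *\<^sub>R hcol y j + (\<rho>1 (s y) * m y $ j) *\<^sub>R hcol y i)
     \<bullet> (U y r k *\<^sub>R V y + (\<rho>1 (s y) * m y $ r) *\<^sub>R W y k + (\<rho>1 (s y) * m y $ k) *\<^sub>R W y r))"
    unfolding C_vec C_up_vec by (simp only: inner_scaleR_left inner_scaleR_right) (simp add: power2_eq_square)
  also have "(U y i j *\<^sub>R m y + (\<rho>1 (s y) * m y $ i) *\<^sub>R hcol y j + (\<rho>1 (s y) * m y $ j) *\<^sub>R hcol y i)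
     \<bullet> (U y r k *\<^sub>R V y + (\<rho>1 (s y) * m y $ r) *\<^sub>R W y k + (\<rho>1 (s y) * m y $ k) *\<^sub>R W y r)
   = U y i j * U y r k * m2 y / Dn y + 2 * \<rho>1 (s y) * (U y i j * m y $ r * m y $ k + U y r k * m y $ i * m y $ j) / Dn y
    + (\<rho>1 (s y))\<^sup>2 * (m y $ i * m y $ r * (hcol y j \<bullet> W y k) + m y $ i * m y $ k * (hcol y j \<bullet> W y r)
       + m y $ j * m y $ r * (hcol y i \<bullet> W y k) + m y $ j * m y $ k * (hcol y i \<bullet> W y r))"
    by (simp add: inner_add m_V m_W hcol_V add_divide_distrib algebra_simps power2_eq_square)
  finally show ?thesis by simp
qed

lemma T_eq: "T_tensor F r i j k y = \<phi> (s y) / (4 * \<alpha> y) *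
    (hh_coeff y * Q1 y r i j k + hmm_coeff y * Q2 y r i j k + mmmm_coeff y * Q3 y r i j k)"
proof -
  note al0 = alpha_pos[OF y_nz]
  \<comment> \<open>Brings all summands of T over the common denominator \<open>4 * A\<close>, where
    \<open>A\<close> is \<alpha>.\<close>
  have comb: "A * f * (p / (2 * A\<^sup>2)) - A * f * (k1 / (4 * A\<^sup>2) + k2 / (4 * A\<^sup>2) + k3 / (4 * A\<^sup>2))
     + n1 / (2 * A) * x1 + n2 / (2 * A) * x2 + n3 / (2 * A) * x3 + n4 / (2 * A) * x4
     = 1 / (4 * A) * (f * (2 * p - k1 - k2 - k3) + 2 * (n1 * x1 + n2 * x2 + n3 * x3 + n4 * x4))"
    if "0 < A" for A f p k1 k2 k3 n1 n2 n3 n4 x1 x2 x3 x4 :: real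
    using that by (simp add: divide_simps power2_eq_square) (simp add: algebra_simps)
  have cancel: "x = f * z \<Longrightarrow> 1 / (4 * A) * x = f / (4 * A) * z" for A f x z :: real
    by simp
  have Fy: "F y = \<alpha> y * \<phi> (s y)" by (simp add: Fm_def)
  \<comment> \<open>Naming the quotients reduces the goal to a polynomial identity; writing
    \<open>\<phi>1\<close> as \<open>u * \<phi>\<close> makes the common factor
    \<open>\<phi>\<close> visible.\<close>
  define u where "u = \<phi>1 (s y) / \<phi> (s y)"
  have u: "\<phi>1 (s y) = u * \<phi> (s y)" using phi_pos[OF sJ] by (simp add: u_def)
  define iD where "iD = 1 / Dn y"
  define ir where "ir = 1 / \<rho> (s y)"
  define e where "e = \<phi> (s y) * \<phi>2 (s y)"
  have iD: "x / Dn y = x * iD" and ir: "x / \<rho> (s y) = x * ir" for x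
    by (simp_all add: iD_def ir_def)
  have Phi: "hh_coeff y = - \<rho>1 (s y) * (2 * s y + \<rho>1 (s y) * m2 y * iD)"
    by (simp add: hh_coeff_def iD)
  have Psi: "hmm_coeff y = - f3 (s y) * (2 * s y + \<rho>1 (s y) * m2 y * iD)
   + 4 * u * \<rho>1 (s y) - 2 * (\<rho>1 (s y))\<^sup>2 * (iD + ir)"
    by (simp add: hmm_coeff_def iD_def ir_def u_def)
  have Om: "mmmm_coeff y = 2 * f4 (s y) + 8 * u * f3 (s y) - 3 * (f3 (s y))\<^sup>2 * m2 y * iD
     - 12 * \<rho>1 (s y) * f3 (s y) * iD + 12 * (\<rho>1 (s y))\<^sup>2 * e * ir * iD"
    by (simp add: mmmm_coeff_def iD_def ir_def u_def e_def)
  show ?thesis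
    unfolding T_tensor_def sum.distrib C_C
    unfolding pd_C_low[OF yD] C_low_eq[OF yD] pd_F[OF yD] Fy comb[OF al0]
      hcol_W U_def iD ir Phi Psi Om S_def Q1_def Q2_def Q3_def
      e_def[symmetric] u
    by (rule cancel) (simp add: h_sym power2_eq_square algebra_simps)
qed

end

section \<open>Nondegeneracy, and the equivalence at a point of the manifold\<close>

text \<open>On a vector annihilated by \<open>al\<close> and \<open>m\<close>, \<open>g\<close> acts
  as \<open>\<rho> (s y)\<close> times \<open>a\<close>, so a zero of \<open>\<rho>\<close> would
  give \<open>g\<close> a kernel.\<close>

lemma rho_nonzero:
  assumes "CARD('n) \<ge> 3" "y \<in> D" "invertible (g_mat F y)"
  shows "\<rho> (s y) \<noteq> 0"
proof
  assume 0: "\<rho> (s y) = 0"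
  obtain v where v: "v \<noteq> 0" "al y \<bullet> v = 0" "m y \<bullet> v = 0"
    using exists_orthogonal_pair[OF assms(1)] by blast
  have "g_mat F y *v v = 0" unfolding g_mult[OF assms(2)] by (simp add: v 0)
  then show False using invertible_ker[OF assms(3)] v(1) by blast
qed

text \<open>If \<open>Dn y = 0\<close>, the vector of \<open>g_V0\<close> lies in the kernel of
  \<open>g\<close> and is zero; pairing it with \<open>m\<close> gives \<open>m2 y = 0\<close>,
  contrary to \<open>m y \<noteq> 0\<close>.\<close>

lemma Dn_nonzero:
  assumes "y \<in> D" "m y \<noteq> 0" "invertible (g_mat F y)"
  shows "Dn y \<noteq> 0"
proof
  assume 0: "Dn y = 0"
  have y0: "y \<noteq> 0" using assms by (auto simp: Dom_def)
  have "matrix_inv a *v m y - (\<phi>1 (s y) / \<phi> (s y) * m2 y / \<alpha> y) *\<^sub>R y = 0"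
    by (rule invertible_ker[OF assms(3)]) (simp only: g_V0[OF assms(1)] 0 scaleR_zero_left)
  then have "m y \<bullet> (matrix_inv a *v m y - (\<phi>1 (s y) / \<phi> (s y) * m2 y / \<alpha> y) *\<^sub>R y) = 0"
    by simp
  then have "m2 y = 0"
    by (simp add: inner_diff_right m_inv_m[OF y0] m_y[OF y0])
  then show False using m2_pos[OF y0 assms(2)] by simp
qed

lemma Phi_eq: assumes "y \<noteq> 0" shows "Phi \<phi> a b y = \<phi> (s y) / (4 * \<alpha> y) * hh_coeff y"
proof -
  define iD where "iD = 1 / Dn y"
  have iD: "x / (2 * \<alpha> y * Dn y) = x * iD / (2 * \<alpha> y)" "x / Dn y = x * iD" for x
    by (simp_all add: iD_def)
  have "Phi \<phi> a b y = - (\<rho>1 (s y) * \<phi> (s y) / (2 * \<alpha> y)) *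
    (s y + \<alpha> y * (\<rho>1 (s y) / (2 * \<alpha> y * Dn y)) * m2 y)"
    by (simp add: Phi_def K1_def Dn_def Let_def)
  then show ?thesis
    using alpha_pos[OF assms] unfolding hh_coeff_def iD by (simp add: field_simps)
qed

text \<open>Contraction with \<open>v\<close> kills \<open>m\<close> and turns \<open>h\<close> into
  \<open>w\<close>, the \<open>a\<close>-dual covector of \<open>v\<close>. Facts \<open>1\<close>,
  \<open>2\<close> and \<open>3\<close> contract one index each.\<close>

lemma T_zero_imp_hh_coeff_zero:
  assumes "CARD('n) \<ge> 3" "y \<in> D" "m y \<noteq> 0" "invertible (g_mat F y)"
    and T: "\<forall>r i j k. T_tensor F r i j k y = 0"
  shows "hh_coeff y = 0"
proof -
  have y0: "y \<noteq> 0" and sJ: "s y \<in> J" using assms(2) by (auto simp: Dom_def)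
  obtain v where v: "v \<noteq> 0" "al y \<bullet> v = 0" "m y \<bullet> v = 0"
    using exists_orthogonal_pair[OF assms(1)] by blast
  define w where "w = a *v v"
  define N where "N = w \<bullet> v"
  have N: "N > 0" using pos[OF v(1)] by (simp add: N_def w_def inner_commute)
  have hv: "hcol y i \<bullet> v = w $ i" for i
    by (simp add: hcol_eq inner_diff_left v w_def inner_a[symmetric] axis_inner)
  note rho = rho_nonzero[OF assms(1,2,4)] and Dn = Dn_nonzero[OF assms(2,3,4)]
  have 0: "hh_coeff y * Q1 y r i j k + hmm_coeff y * Q2 y r i j k + mmmm_coeff y * Q3 y r i j k = 0" for r i j k
    using T T_eq[OF assms(2) rho Dn assms(4), of r i j k] alpha_pos[OF y0] phi_pos[OF sJ] by simp
  have 1: "hh_coeff y * (w $ i * h y j k + w $ j * h y i k + w $ k * h y i j)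
     + hmm_coeff y * (w $ i * m y $ j * m y $ k + w $ j * m y $ i * m y $ k + w $ k * m y $ i * m y $ j) = 0" for i j k
  proof -
    have "(\<chi> r. hh_coeff y * Q1 y r i j k + hmm_coeff y * Q2 y r i j k + mmmm_coeff y * Q3 y r i j k)
      = (hh_coeff y * h y j k + hmm_coeff y * m y $ j * m y $ k) *\<^sub>R hcol y i
        + (hh_coeff y * h y i k + hmm_coeff y * m y $ i * m y $ k) *\<^sub>R hcol y j
        + (hh_coeff y * h y i j + hmm_coeff y * m y $ i * m y $ j) *\<^sub>R hcol y k
        + (hmm_coeff y * (h y i j * m y $ k + h y i k * m y $ j + h y j k * m y $ i)
           + mmmm_coeff y * m y $ i * m y $ j * m y $ k) *\<^sub>R m y" (is "_ = ?X")
      by (simp add: vec_eq_iff Q1_def Q2_def Q3_def hcol_def algebra_simps)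
    then have "?X = 0" by (simp add: 0 vec_eq_iff)
    then have "?X \<bullet> v = 0" by (simp only: inner_zero_left)
    then show ?thesis by (simp add: inner_add_left hv v algebra_simps)
  qed
  have 2: "hh_coeff y * (N * h y j k + 2 * w $ j * w $ k) + hmm_coeff y * N * m y $ j * m y $ k = 0" for j k
  proof -
    have "(\<chi> i. hh_coeff y * (w $ i * h y j k + w $ j * h y i k + w $ k * h y i j)
     + hmm_coeff y * (w $ i * m y $ j * m y $ k + w $ j * m y $ i * m y $ k + w $ k * m y $ i * m y $ j))
      = (hh_coeff y * h y j k + hmm_coeff y * m y $ j * m y $ k) *\<^sub>R w
       + (hh_coeff y * w $ j) *\<^sub>R hcol y k + (hh_coeff y * w $ k) *\<^sub>R hcol y j
       + (hmm_coeff y * (w $ j * m y $ k + w $ k * m y $ j)) *\<^sub>R m y" (is "_ = ?X")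
      by (simp add: vec_eq_iff hcol_def algebra_simps)
    then have "?X = 0" by (simp add: 1 vec_eq_iff)
    then have "?X \<bullet> v = 0" by (simp only: inner_zero_left)
    then show ?thesis by (simp add: inner_add_left hv v N_def[symmetric] algebra_simps)
  qed
  \<comment> \<open>All terms with \<open>m\<close> are gone, and the nonzero covector
    \<open>w\<close> takes the place of a fourth contraction.\<close>
  have 3: "hh_coeff y * 3 * N * w $ k = 0" for k
  proof -
    have "(\<chi> j. hh_coeff y * (N * h y j k + 2 * w $ j * w $ k) + hmm_coeff y * N * m y $ j * m y $ k)
      = (hh_coeff y * N) *\<^sub>R hcol y k + (hh_coeff y * 2 * w $ k) *\<^sub>R w + (hmm_coeff y * N * m y $ k) *\<^sub>R m y" (is "_ = ?X")
      by (simp add: vec_eq_iff hcol_def algebra_simps)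
    then have "?X = 0" by (simp add: 2 vec_eq_iff)
    then have "?X \<bullet> v = 0" by (simp only: inner_zero_left)
    then show ?thesis by (simp add: inner_add_left hv v N_def[symmetric] algebra_simps)
  qed
  have "w \<noteq> 0" using a_ker v(1) by (auto simp: w_def)
  then obtain k where "w $ k \<noteq> 0" by (auto simp: vec_eq_iff)
  then show ?thesis using 3[of k] N by auto
qed

text \<open>In the plane of the dual vector \<open>c\<close> of \<open>b\<close> and an
  \<open>a\<close>-orthogonal \<open>v\<close>, the \<open>c\<close> component fixes \<beta> and the
  \<open>v\<close> component adjusts \<alpha>.\<close>

lemma s_surj:
  assumes "CARD('n) \<ge> 3" "t \<in> J" "t\<^sup>2 < b_sq a b"
  obtains y where "y \<in> Dom_star J a b" "s y = t"
proof -
  define B where "B = b_sq a b"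
  have B: "B > 0" using assms(3) zero_le_power2[of t] unfolding B_def by linarith
  define c where "c = matrix_inv a *v b"
  have ac: "a *v c = b" by (simp add: c_def a_inv)
  have bc: "b \<bullet> c = B" by (simp add: c_def b_sq_eq B_def)
  obtain v where v: "v \<noteq> 0" "b \<bullet> v = 0"
    using exists_orthogonal_pair[OF assms(1)] by blast
  define N where "N = v \<bullet> (a *v v)"
  have N: "N > 0" using pos[OF v(1)] by (simp add: N_def)
  \<comment> \<open>Chosen so that \<open>\<alpha> y = B\<close>; since \<beta> is
    \<open>t * B\<close> at \<open>y\<close>, this gives \<open>s y = t\<close>.\<close>
  define q where "q = sqrt (B * (B - t\<^sup>2) / N)"
  have q: "q\<^sup>2 * N = B * (B - t\<^sup>2)" using B N assms(3) by (simp add: q_def B_def)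
  define y where "y = t *\<^sub>R c + q *\<^sub>R v"
  have cv: "c \<bullet> (a *v v) = 0" using v(2) by (simp add: inner_a ac)
  have "y \<bullet> (a *v y) = t\<^sup>2 * B + q\<^sup>2 * N"
    using cv v(2) bc unfolding y_def N_def
    by (simp add: matrix_vector_right_distrib matrix_vector_mult_scaleR inner_add ac
        inner_commute[of c b] inner_commute[of v b] power2_eq_square)
  also have "\<dots> = B\<^sup>2" unfolding q by (simp add: power2_eq_square algebra_simps)
  finally have al: "\<alpha> y = B" using B by (simp add: alpha_eq)
  have y0: "y \<noteq> 0" using al B by (auto simp: alpha_eq)
  have sy: "s y = t"
    using B unfolding s_var_def al beta_eq by (simp add: y_def inner_add_right v(2) bc)
  have "m2 y > 0" using assms(3) by (simp add: m_sq_def sy)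
  then have "m y \<noteq> 0" using m_inv_m[OF y0] by auto
  then have "y \<in> Dom_star J a b"
    using y0 sy assms(2) by (simp add: Dom_star_def Dom_def m_cov_eq)
  then show ?thesis using sy that by blast
qed

lemma T_condition_iff_Phi_zero:
  assumes n3: "CARD('n) \<ge> 3"
    and inv: "\<And>y. y \<in> D \<Longrightarrow> invertible (g_mat F y)"
  shows "(\<forall>y\<in>Dom_star J a b. \<forall>h i j k. T_tensor F h i j k y = 0) \<longleftrightarrow>
    (\<forall>y\<in>Dom_star J a b. Phi \<phi> a b y = 0)"
proof -
  have star: "y \<in> D" "y \<noteq> 0" "s y \<in> J" "m y \<noteq> 0" if "y \<in> Dom_star J a b" for y
    using that by (auto simp: Dom_star_def Dom_def m_cov_eq)
  show ?thesis
  proof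
    assume T: "\<forall>y\<in>Dom_star J a b. \<forall>h i j k. T_tensor F h i j k y = 0"
    show "\<forall>y\<in>Dom_star J a b. Phi \<phi> a b y = 0"
    proof
      fix y assume y: "y \<in> Dom_star J a b"
      then have "hh_coeff y = 0" using T star[OF y] inv by (intro T_zero_imp_hh_coeff_zero[OF n3]) auto
      then show "Phi \<phi> a b y = 0" using Phi_eq star[OF y] by simp
    qed
  next
    assume Phi: "\<forall>y\<in>Dom_star J a b. Phi \<phi> a b y = 0"
    define B where "B = b_sq a b"
    \<comment> \<open>\<open>I\<close> is the set of values of \<open>s\<close> on
      \<open>Dom_star J a b\<close>: one inclusion is \<open>s_surj\<close>, the other
      \<open>m2_pos\<close>.\<close>
    define I where "I = J \<inter> {t. t\<^sup>2 < B}"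
    \<comment> \<open>With b^2 constant, \<open>Dn\<close> depends on \<open>y\<close> only through
      \<open>s\<close>.\<close>
    define Ds where "Ds = (\<lambda>t. \<rho> t + (B - t\<^sup>2) * \<phi> t * \<phi>2 t)"
    have Ds: "Dn y = Ds (s y)" for y by (simp add: Dn_def Ds_def m_sq_def B_def)
    have I: "\<rho> t \<noteq> 0 \<and> Ds t \<noteq> 0 \<and> \<rho>1 t * (2 * t * Ds t + \<rho>1 t * (B - t\<^sup>2)) = 0" if tI: "t \<in> I" for t
    proof -
      obtain y where y: "y \<in> Dom_star J a b" "s y = t"
        using s_surj[OF n3, of t] tI by (auto simp: I_def B_def)
      note yy = star[OF y(1)]
      have nz: "\<rho> t \<noteq> 0" "Ds t \<noteq> 0"
        using rho_nonzero[OF n3 yy(1) inv[OF yy(1)]] Dn_nonzero[OF yy(1,4) inv[OF yy(1)]] Ds[of y] y(2) by auto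
      have "hh_coeff y = 0"
        using Phi y(1) Phi_eq[OF yy(2)] alpha_pos[OF yy(2)] phi_pos[OF yy(3)] by simp
      then have "- \<rho>1 t * (2 * t + \<rho>1 t * (B - t\<^sup>2) / Ds t) = 0"
        by (simp add: hh_coeff_def Ds y(2) m_sq_def B_def)
      then show ?thesis using nz by (auto simp: field_simps)
    qed
    have open_I: "open I"
      unfolding I_def by (intro open_Int open_J open_Collect_less continuous_intros)
    have cont: "continuous_on I f" if "\<And>t. t \<in> J \<Longrightarrow> (f has_real_derivative f' t) (at t)" for f f'
      using DERIV_isCont[OF that] by (intro continuous_at_imp_continuous_on) (auto simp: I_def)
    have cont4: "continuous_on J \<phi>4"
    proof -
      have "(deriv ^^ 4) \<phi> differentiable_on J" using smooth by (auto simp: smooth_real_on_def)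
      then have "\<phi>4 differentiable_on J" by (simp add: eval_nat_numeral)
      then show ?thesis by (rule differentiable_imp_continuous_on)
    qed
    interpret ode: tcond_ode I B \<phi> \<phi>1 \<phi>2 f3 f4 \<rho> \<rho>1 Ds
    proof
      show "continuous_on I f4"
        unfolding f4_def[abs_def]
        by (intro continuous_intros cont[of \<phi>, OF phi_derivs(1)] cont[of \<phi>1, OF phi_derivs(2)]
            cont[of \<phi>2, OF phi_derivs(3)] cont[of \<phi>3, OF phi_derivs(4)] continuous_on_subset[OF cont4])
          (auto simp: I_def)
      show "continuous_on I \<phi>2" by (rule cont[OF phi_derivs(3)])
      show "\<rho> t = \<phi> t * (\<phi> t - t * \<phi>1 t)" for t
        by (simp add: rho_def power2_eq_square algebra_simps)
      show "\<rho>1 t = \<phi> t * \<phi>1 t - t * ((\<phi>1 t)\<^sup>2 + \<phi> t * \<phi>2 t)" for t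
        by (simp add: rho1_def)
      show "Ds t = \<rho> t + (B - t\<^sup>2) * \<phi> t * \<phi>2 t" for t
        by (simp add: Ds_def)
    qed (use open_I I in \<open>auto simp: I_def phi_pos intro: phi_derivs f3_deriv rho_deriv rho1_deriv[simplified]\<close>)
    show "\<forall>y\<in>Dom_star J a b. \<forall>h i j k. T_tensor F h i j k y = 0"
    proof (intro ballI allI)
      fix y r i j k assume y: "y \<in> Dom_star J a b"
      note yy = star[OF y]
      have sI: "s y \<in> I" using m2_pos[OF yy(2,4)] yy(3) by (simp add: I_def B_def m_sq_def)
      have "hh_coeff y = 0"
        using Phi y Phi_eq[OF yy(2)] alpha_pos[OF yy(2)] phi_pos[OF yy(3)] by simp
      moreover have "hmm_coeff y = 0" using ode.Psi_zero[OF sI] unfolding ode.\<Psi>_def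
        by (simp add: hmm_coeff_def Ds m_sq_def B_def)
      moreover have "mmmm_coeff y = 0" using ode.Omega_zero[OF sI] unfolding ode.\<Omega>_def
        by (simp add: mmmm_coeff_def Ds m_sq_def B_def)
      moreover have "\<rho> (s y) \<noteq> 0" "Dn y \<noteq> 0" using I[OF sI] Ds by auto
      ultimately show "T_tensor F r i j k y = 0"
        using T_eq[OF yy(1) _ _ inv[OF yy(1)]] by simp
    qed
  qed
qed

end

theorem theorem3p1:
  fixes M :: "'m::{t2_space, second_countable_topology} set"
    and A :: "('m, 'n::finite) chart set"
    and a :: "('m, 'n) chart \<Rightarrow> 'm \<Rightarrow> real^'n^'n"
    and b :: "('m, 'n) chart \<Rightarrow> 'm \<Rightarrow> real^'n"
    and b\<^sub>0 :: real and J :: "real set" and \<phi> :: "real \<Rightarrow> real"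
  assumes "CARD('n) \<ge> 3"
    and "smooth_manifold M A"
    and "riemannian_metric A a"
    and "one_form A b"
    and "b\<^sub>0 > 0"
    and "J = {-b\<^sub>0<..<b\<^sub>0} \<or> J = {0<..<b\<^sub>0}"
    and "smooth_real_on J \<phi>"
    and "\<forall>\<kappa>\<in>A. \<forall>p\<in>fst \<kappa>. sqrt (b_sq (a \<kappa> p) (b \<kappa> p)) \<le> b\<^sub>0"
    and "\<forall>t\<in>J. \<phi> t > 0"
    and "\<forall>t\<in>J. \<forall>x. \<bar>t\<bar> < x \<and> x < b\<^sub>0 \<longrightarrow>
           \<phi> t - t * deriv \<phi> t + (x\<^sup>2 - t\<^sup>2) * deriv (deriv \<phi>) t > 0"
    and "\<forall>\<kappa>\<in>A. \<forall>p\<in>fst \<kappa>. \<forall>y\<in>Dom J (a \<kappa> p) (b \<kappa> p).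
           invertible (g_mat (Fm \<phi> (a \<kappa> p) (b \<kappa> p)) y)"
    and "\<forall>\<kappa>\<in>A. \<forall>p\<in>fst \<kappa>. b \<kappa> p \<noteq> 0"
  shows "(\<forall>\<kappa>\<in>A. \<forall>p\<in>fst \<kappa>. \<forall>y\<in>Dom_star J (a \<kappa> p) (b \<kappa> p).
            \<forall>h i j k. T_tensor (Fm \<phi> (a \<kappa> p) (b \<kappa> p)) h i j k y = 0)
     \<longleftrightarrow> (\<forall>\<kappa>\<in>A. \<forall>p\<in>fst \<kappa>. \<forall>y\<in>Dom_star J (a \<kappa> p) (b \<kappa> p).
            Phi \<phi> (a \<kappa> p) (b \<kappa> p) y = 0)"
proof (rule ball_cong[OF refl], rule ball_cong[OF refl])
  fix \<kappa> p assume \<kappa>: "\<kappa> \<in> A" "p \<in> fst \<kappa>"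
  \<comment> \<open>T and \<Phi> involve only the components of \<open>a\<close> and
    \<open>b\<close> at \<open>p\<close>, so the equivalence holds separately for each chart and
    point.\<close>
  interpret alpha_beta_point "a \<kappa> p" "b \<kappa> p" J \<phi>
  proof
    show "open J" using assms(6) by auto
    show "transpose (a \<kappa> p) = a \<kappa> p" "\<And>y. y \<noteq> 0 \<Longrightarrow> 0 < y \<bullet> (a \<kappa> p *v y)"
      using assms(3) \<kappa> unfolding riemannian_metric_def by auto
  qed (use assms(7,9) in auto)
  show "(\<forall>y\<in>Dom_star J (a \<kappa> p) (b \<kappa> p).
            \<forall>h i j k. T_tensor (Fm \<phi> (a \<kappa> p) (b \<kappa> p)) h i j k y = 0)
     \<longleftrightarrow> (\<forall>y\<in>Dom_star J (a \<kappa> p) (b \<kappa> p). Phi \<phi> (a \<kappa> p) (b \<kappa> p) y = 0)"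
    by (rule T_condition_iff_Phi_zero[OF assms(1)]) (use assms(11) \<kappa> in auto)
qed

end
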